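(* Let $n\ge 1$, $s\in(0,1)$, and let $\Omega\subset\mathbb{R}^n$ be open, bounded, with $C^{1,1}$ boundary. Let $u:\mathbb{R}^n\to\mathbb{R}$ be such that $u\in C^{2s+\alpha}_{loc}(\Omega)\cap L^\infty(\Omega)$ for some $\alpha>0$ and $$\widetilde{\mathcal N}_s u(x)=0\qquad\text{for a.e. } x\in\mathbb{R}^n\setminus\Omega .$$ Then, for every $x\in\Omega$, $$(-\Delta)^s u(x)=(-\Delta)^s_\Omega u(x)+c_{n,s}\int_\Omega\big(u(x)-u(y)\big)\,k(x,y)\,dy=c_{n,s}\,\mathrm{p.v.}\int_\Omega\big(u(x)-u(y)\big)\left(\frac1{|x-y|^{n+2s}}+k(x,y)\right)dy,$$ where $$k(x,y):=\int_{\mathbb{R}^n\setminus\Omega}\frac{dz}{|x-z|^{n+2s}\,|y-z|^{n+2s}\displaystyle\int_\Omega\frac{dw}{|z-w|^{n+2s}}},\qquad x,y\in\Omega,$$ is positive, symmetric, continuous, and for any fixed $x\in\Omega$ there exists $C=C(x)>0$ such that $$k(x,y)\le C\big(1+|\ln\mathrm{dist}(y,\mathbb{R}^n\setminus\Omega)|\big)\qquad\text{for any } y\in\Omega .$$ Moreover, it also holds $$k(x,y)\ge\frac1C\big(1+|\ln\mathrm{dist}(y,\mathbb{R}^n\setminus\Omega)|\big)\qquad\text{for any } y\in\Omega .$$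
   Context: Here $c_{n,s}>0$ is a fixed normalizing constant depending only on $n$ and $s$. For a function $u:\mathbb{R}^n\to\mathbb{R}$, the fractional Laplacian is $$(-\Delta)^s u(x)=c_{n,s}\,\mathrm{p.v.}\int_{\mathbb{R}^n}\frac{u(x)-u(y)}{|x-y|^{n+2s}}\,dy=c_{n,s}\lim_{\varepsilon\downarrow0}\int_{\mathbb{R}^n\setminus B_\varepsilon(x)}\frac{u(x)-u(y)}{|x-y|^{n+2s}}\,dy .$$ The regional fractional Laplacian is $$(-\Delta)^s_\Omega u(x)=c_{n,s}\,\mathrm{p.v.}\int_\Omega\frac{u(x)-u(y)}{|x-y|^{n+2s}}\,dy,\qquad x\in\Omega .$$ In both cases (and for any integral over $\Omega$ marked p.v.) the principal value means the limit as $\varepsilon\downarrow0$ of the integral over the domain minus $B_\varepsilon(x)$. The (normalized) nonlocal normal derivative is $$\widetilde{\mathcal N}_s u(x)=\left(\int_\Omega\frac{dy}{|x-y|^{n+2s}}\right)^{-1}\int_\Omega\frac{u(x)-u(y)}{|x-y|^{n+2s}}\,dy,\qquad x\in\mathbb{R}^n\setminus\Omega .$$ For nonempty $\Sigma\subset\mathbb{R}^n$, $\mathrm{dist}(x,\Sigma)=\inf\{|x-y|:y\in\Sigma\}$. "Symmetric" means $k(x,y)=k(y,x)$. *)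

theory Defs
  imports "HOL-Analysis.Analysis"
begin

(* The integrands are only Lebesgue measurable in general, so integrals are taken
   with respect to lebesgue, not lborel. *)

section \<open>Regularity of the domain and of functions\<close>

(* Near each boundary point \<Omega> lies strictly on one side of the graph of a C^{1,1} function
   over a hyperplane orthogonal to a unit vector e.  The graph function g is defined on the
   whole space but evaluated only at projections onto that hyperplane; this loses nothing,
   since a C^{1,1} function on the hyperplane extends by composing with the projection.
   In dimension one the hyperplane is {0} and the graph is a single point. *)
definition C11_boundary :: "'a::euclidean_space set \<Rightarrow> bool" where
  "C11_boundary \<Omega> \<longleftrightarrow>
    (\<forall>p \<in> frontier \<Omega>. \<exists>r > 0. \<exists>e. \<exists>g :: 'a \<Rightarrow> real. \<exists>G :: 'a \<Rightarrow> 'a. \<exists>L.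
       norm e = 1 \<and>
       (\<forall>z. (g has_derivative (\<lambda>h. G z \<bullet> h)) (at z)) \<and> L-lipschitz_on UNIV G \<and>
       \<Omega> \<inter> ball p r = {x \<in> ball p r. x \<bullet> e > g (x - (x \<bullet> e) *\<^sub>R e)})"

primrec holder_class_loc ::
    "nat \<Rightarrow> real \<Rightarrow> 'a::euclidean_space set \<Rightarrow> ('a \<Rightarrow> real) \<Rightarrow> bool" where
  "holder_class_loc 0 \<gamma> \<Omega> = (\<lambda>f.
     \<forall>K. compact K \<longrightarrow> K \<subseteq> \<Omega> \<longrightarrow>
       (\<exists>C. \<forall>x\<in>K. \<forall>y\<in>K. \<bar>f x - f y\<bar> \<le> C * norm (x - y) powr \<gamma>))"
| "holder_class_loc (Suc m) \<gamma> \<Omega> = (\<lambda>f.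
     \<exists>G. (\<forall>x\<in>\<Omega>. (f has_derivative (\<lambda>h. G x \<bullet> h)) (at x)) \<and>
         (\<forall>b\<in>Basis. holder_class_loc m \<gamma> \<Omega> (\<lambda>x. G x \<bullet> b)))"

(* C^\<beta>_loc(\<Omega>) for \<beta> > 0 is C^{m,\<gamma>}_loc(\<Omega>) with \<beta> = m + \<gamma>, m a natural number and
   0 < \<gamma> \<le> 1; so an integer \<beta> is read as C^{\<beta>-1,1}.  For a hypothesis of the form
   "C^{2s+\<alpha>}_loc for some \<alpha> > 0" the reading at integers is immaterial: \<alpha> can be decreased. *)
definition C_loc :: "real \<Rightarrow> 'a::euclidean_space set \<Rightarrow> ('a \<Rightarrow> real) \<Rightarrow> bool" where
  "C_loc \<beta> \<Omega> f \<longleftrightarrow>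
     holder_class_loc (nat (\<lceil>\<beta>\<rceil> - 1)) (\<beta> - of_int (\<lceil>\<beta>\<rceil> - 1)) \<Omega> f"

definition Linfty_on :: "'a::euclidean_space set \<Rightarrow> ('a \<Rightarrow> real) \<Rightarrow> bool" where
  "Linfty_on \<Omega> f \<longleftrightarrow>
     f \<in> borel_measurable (lebesgue_on \<Omega>) \<and> (\<exists>M. AE x in lebesgue_on \<Omega>. \<bar>f x\<bar> \<le> M)"

section \<open>Principal values\<close>

definition pv_integral :: "'a::euclidean_space \<Rightarrow> 'a set \<Rightarrow> ('a \<Rightarrow> real) \<Rightarrow> real" where
  "pv_integral x D f = Lim (at_right 0) (\<lambda>\<epsilon>. LINT y : D - ball x \<epsilon> | lebesgue. f y)"

(* pv_integral is total; pv_integrable says that its value is meaningful. *)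
definition pv_integrable :: "'a::euclidean_space \<Rightarrow> 'a set \<Rightarrow> ('a \<Rightarrow> real) \<Rightarrow> bool" where
  "pv_integrable x D f \<longleftrightarrow>
     (\<forall>\<epsilon> > 0. set_integrable lebesgue (D - ball x \<epsilon>) f) \<and>
     (\<exists>l. ((\<lambda>\<epsilon>. LINT y : D - ball x \<epsilon> | lebesgue. f y) \<longlongrightarrow> l) (at_right 0))"

section \<open>Nonlocal operators\<close>

definition frac_kernel :: "real \<Rightarrow> 'a::euclidean_space \<Rightarrow> 'a \<Rightarrow> real" where
  "frac_kernel s x y = 1 / norm (x - y) powr (real DIM('a) + 2 * s)"

(* c is the normalizing constant c_{n,s}. *)
definition frac_laplacian ::
    "real \<Rightarrow> real \<Rightarrow> ('a::euclidean_space \<Rightarrow> real) \<Rightarrow> 'a \<Rightarrow> real" where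
  "frac_laplacian c s u x = c * pv_integral x UNIV (\<lambda>y. (u x - u y) * frac_kernel s x y)"

definition regional_frac_laplacian ::
    "real \<Rightarrow> real \<Rightarrow> 'a::euclidean_space set \<Rightarrow> ('a \<Rightarrow> real) \<Rightarrow> 'a \<Rightarrow> real" where
  "regional_frac_laplacian c s \<Omega> u x =
     c * pv_integral x \<Omega> (\<lambda>y. (u x - u y) * frac_kernel s x y)"

definition nonlocal_normal_deriv ::
    "real \<Rightarrow> 'a::euclidean_space set \<Rightarrow> ('a \<Rightarrow> real) \<Rightarrow> 'a \<Rightarrow> real" where
  "nonlocal_normal_deriv s \<Omega> u x =
     inverse (LINT y : \<Omega> | lebesgue. frac_kernel s x y) *
     (LINT y : \<Omega> | lebesgue. (u x - u y) * frac_kernel s x y)"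

(* On the boundary of \<Omega> the inner integral diverges; there both the mathematical convention
   1/\<infinity> = 0 and the formal value 1/0 = 0 give integrand 0 (on a null set). *)
definition neumann_kernel ::
    "real \<Rightarrow> 'a::euclidean_space set \<Rightarrow> 'a \<Rightarrow> 'a \<Rightarrow> real" where
  "neumann_kernel s \<Omega> x y =
     (LINT z : - \<Omega> | lebesgue.
        frac_kernel s x z * frac_kernel s y z / (LINT w : \<Omega> | lebesgue. frac_kernel s z w))"

end

theory Submission
  imports Defs
begin

text \<open>
  Of the \<open>C\<^sup>1\<^sup>,\<^sup>1\<close> regularity only two consequences are used: the boundary is a null set, and both
  \<open>\<Omega>\<close> and its complement contain, near every boundary point \<open>p\<close> and at every small scale \<open>\<rho>\<close>, a ball of
  radius \<open>\<kappa> \<rho>\<close> inside the ball of radius \<open>\<rho>\<close> about \<open>p\<close>.  With \<open>N z\<close> the integral of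
  \<open>|z - w|\<^sup>-\<^sup>n\<^sup>-\<^sup>2\<^sup>s\<close> over \<open>w \<in> \<Omega>\<close> and \<open>d z\<close> the distance of \<open>z\<close> to \<open>\<Omega>\<close>, the interior balls give \<open>N z \<sim> d z\<^sup>-\<^sup>2\<^sup>s\<close>
  near the boundary.  Since \<open>d z \<le> |y - z|\<close> for \<open>y \<in> \<Omega>\<close>, the integrand of \<open>k(x, y)\<close> is at most a multiple of
  \<open>|y - z|\<^sup>-\<^sup>n\<close> near \<open>y\<close>, whose integral outside the ball of radius \<open>dist(y, \<partial>\<Omega>)\<close> is logarithmic.  Conversely
  the exterior balls at the scales \<open>\<Lambda>\<^sup>j dist(y, \<partial>\<Omega>)\<close> are disjoint, each contributes the same constant to
  \<open>k(x, y)\<close>, and there are about \<open>|ln dist(y, \<partial>\<Omega>)|\<close> of them.  The Neumann condition says that \<open>u z\<close> is the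
  weighted mean of \<open>u\<close> over \<open>\<Omega>\<close> for almost every exterior \<open>z\<close>; inserting this into the exterior part of the
  fractional Laplacian and applying Fubini produces \<open>k\<close>.
\<close>

section \<open>Corkscrew conditions\<close>

text \<open>Mean value inequality in gradient form. It serves both the graph functions of the
  boundary and the local expansion of \<open>u\<close>.\<close>

lemma gradient_bound_imp_lipschitz:
  fixes f :: "'a::euclidean_space \<Rightarrow> real"
  assumes "convex S" "\<And>x. x \<in> S \<Longrightarrow> (f has_derivative (\<lambda>h. G x \<bullet> h)) (at x)"
    and B: "\<And>x. x \<in> S \<Longrightarrow> norm (G x) \<le> B" and "x \<in> S" "y \<in> S"
  shows "\<bar>f x - f y\<bar> \<le> B * norm (x - y)"
proof -
  have "norm (f x - f y) \<le> B * norm (x - y)"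
  proof (rule differentiable_bound[OF assms(1), where f' = "\<lambda>z h. G z \<bullet> h"])
    fix z assume z: "z \<in> S"
    show "(f has_derivative (\<lambda>h. G z \<bullet> h)) (at z within S)"
      using assms(2)[OF z] by (rule has_derivative_at_withinI)
    show "onorm (\<lambda>h. G z \<bullet> h) \<le> B"
    proof (rule onorm_le)
      fix h
      have "norm (G z \<bullet> h) \<le> norm (G z) * norm h" using Cauchy_Schwarz_ineq2[of "G z" h] by simp
      also have "\<dots> \<le> B * norm h" using B[OF z] by (rule mult_right_mono) simp
      finally show "norm (G z \<bullet> h) \<le> B * norm h" .
    qed
  qed (use assms in auto)
  then show ?thesis by simp
qed

text \<open>The interior corkscrew condition known from nontangentially accessible domains, uniform
  along the frontier. Applied to \<open>- \<Omega>\<close>, which has the same frontier as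
  \<open>\<Omega>\<close>, it becomes the exterior condition.\<close>

definition corkscrew :: "real \<Rightarrow> real \<Rightarrow> 'a::euclidean_space set \<Rightarrow> bool" where
  "corkscrew \<kappa> r A \<longleftrightarrow>
     (\<forall>p\<in>frontier A. \<forall>\<rho>. 0 < \<rho> \<longrightarrow> \<rho> \<le> r \<longrightarrow> (\<exists>q. ball q (\<kappa> * \<rho>) \<subseteq> ball p \<rho> \<inter> A))"

text \<open>Near \<open>p\<close> the set \<open>\<Omega>\<close> is where the height
  \<open>\<phi>\<close> above the graph is positive. Shifting a frontier point by
  \<open>\<rho>/2\<close> along \<open>e\<close> or \<open>- e\<close> moves \<open>\<phi>\<close>
  by exactly that amount, and the Lipschitz bound on \<open>\<phi>\<close> preserves the sign on a
  ball of comparable radius. The frontier near \<open>p\<close> lies in the image of a hyperplane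
  under a differentiable map, hence is null.\<close>

lemma corkscrew_local:
  fixes \<Omega> :: "'a::euclidean_space set"
  assumes "open \<Omega>" "C11_boundary \<Omega>" "p \<in> frontier \<Omega>"
  obtains \<kappa> R where "0 < \<kappa>" "0 < R" "negligible (frontier \<Omega> \<inter> ball p R)"
    "\<And>p' \<rho>. p' \<in> frontier \<Omega> \<Longrightarrow> p' \<in> ball p R \<Longrightarrow> 0 < \<rho> \<Longrightarrow> \<rho> \<le> R \<Longrightarrow>
       (\<exists>q. ball q (\<kappa> * \<rho>) \<subseteq> ball p' \<rho> \<inter> \<Omega>) \<and> (\<exists>q. ball q (\<kappa> * \<rho>) \<subseteq> ball p' \<rho> \<inter> - \<Omega>)"
proof -
  from assms obtain r e g G L where r: "0 < r" and e: "norm e = 1"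
    and g: "\<And>z. (g has_derivative (\<lambda>h. G z \<bullet> h)) (at z)" and L: "L-lipschitz_on UNIV G"
    and graph: "\<Omega> \<inter> ball p r = {x \<in> ball p r. x \<bullet> e > g (x - (x \<bullet> e) *\<^sub>R e)}"
    unfolding C11_boundary_def by blast
  define P where "P x = x - (x \<bullet> e) *\<^sub>R e" for x :: 'a
  define \<phi> where "\<phi> x = x \<bullet> e - g (P x)" for x
  have ee: "e \<bullet> e = 1" using e by (simp add: norm_eq_1)
  have \<Omega>_iff: "x \<in> \<Omega> \<longleftrightarrow> \<phi> x > 0" if "x \<in> ball p r" for x
  proof -
    have "x \<in> \<Omega> \<longleftrightarrow> x \<in> \<Omega> \<inter> ball p r" using that by blast
    also have "\<dots> \<longleftrightarrow> x \<in> {x \<in> ball p r. x \<bullet> e > g (x - (x \<bullet> e) *\<^sub>R e)}" by (simp only: graph)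
    also have "\<dots> \<longleftrightarrow> \<phi> x > 0" using that by (simp add: \<phi>_def P_def)
    finally show ?thesis .
  qed
  have Pdist: "norm (P x - P y) \<le> 2 * norm (x - y)" for x y
  proof -
    have "P x - P y = (x - y) - ((x - y) \<bullet> e) *\<^sub>R e" by (simp add: P_def algebra_simps)
    then have "norm (P x - P y) \<le> norm (x - y) + \<bar>(x - y) \<bullet> e\<bar>"
      using norm_triangle_ineq4[of "x - y" "((x - y) \<bullet> e) *\<^sub>R e"] e by simp
    also have "\<bar>(x - y) \<bullet> e\<bar> \<le> norm (x - y)"
      using Cauchy_Schwarz_ineq2[of "x - y" e] e by simp
    finally show ?thesis by simp
  qed
  \<comment> \<open>Bounds \<open>norm (G z)\<close> on \<open>ball (P p) (2 * r)\<close>;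
    \<open>G\<close> is Lipschitz but possibly unbounded on the whole space. The radius doubles
    because \<open>P\<close> is estimated crudely as 2-Lipschitz.\<close>
  define M where "M = norm (G (P p)) + L * (2 * r)"
  have L0: "0 \<le> L" using L lipschitz_on_nonneg by blast
  have M0: "0 \<le> M" using r L0 by (simp add: M_def)
  have gM: "\<bar>g x - g y\<bar> \<le> M * norm (x - y)" if "x \<in> ball (P p) (2 * r)" "y \<in> ball (P p) (2 * r)" for x y
  proof (rule gradient_bound_imp_lipschitz[OF convex_ball g _ that])
    fix z assume z: "z \<in> ball (P p) (2 * r)"
    have "norm (G z) \<le> norm (G (P p)) + dist (G z) (G (P p))"
      by (metis dist_norm norm_triangle_sub)
    also have "dist (G z) (G (P p)) \<le> L * dist z (P p)" using L by (simp add: lipschitz_on_def)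
    also have "\<dots> \<le> L * (2 * r)" using z L0 by (intro mult_left_mono) (auto simp: dist_commute)
    finally show "norm (G z) \<le> M" by (simp add: M_def)
  qed
  have Pball: "P x \<in> ball (P p) (2 * r)" if "x \<in> ball p r" for x
    using Pdist[of p x] that by (simp add: dist_norm)
  have \<phi>M: "\<bar>\<phi> x - \<phi> y\<bar> \<le> (1 + 2 * M) * norm (x - y)" if "x \<in> ball p r" "y \<in> ball p r" for x y
  proof -
    have "\<bar>\<phi> x - \<phi> y\<bar> \<le> \<bar>(x - y) \<bullet> e\<bar> + \<bar>g (P x) - g (P y)\<bar>"
      by (simp add: \<phi>_def inner_diff_left)
    also have "\<bar>(x - y) \<bullet> e\<bar> \<le> norm (x - y)"
      using Cauchy_Schwarz_ineq2[of "x - y" e] e by simp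
    also have "\<bar>g (P x) - g (P y)\<bar> \<le> M * norm (P x - P y)" using gM Pball that by blast
    also have "\<dots> \<le> M * (2 * norm (x - y))" using Pdist M0 by (rule mult_left_mono)
    finally show ?thesis by (simp add: algebra_simps)
  qed
  have \<phi>e: "\<phi> (x + t *\<^sub>R e) = \<phi> x + t" for x t
    by (simp add: \<phi>_def P_def inner_add_left ee algebra_simps)
  have contg: "continuous_on UNIV g"
    by (meson continuous_at_imp_continuous_on g has_derivative_continuous)
  have cont: "continuous_on UNIV \<phi>"
    unfolding \<phi>_def P_def by (intro continuous_intros continuous_on_compose2[OF contg]) auto
  have \<phi>0: "\<phi> p' = 0" if "p' \<in> frontier \<Omega>" "p' \<in> ball p r" for p'
  proof -
    have "p' \<notin> \<Omega>" using that(1) \<open>open \<Omega>\<close> by (simp add: frontier_def interior_open)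
    then have "\<phi> p' \<le> 0" using \<Omega>_iff that(2) by force
    \<comment> \<open>Otherwise \<open>\<phi>\<close> is negative on a neighbourhood of
      \<open>p'\<close>, which then misses \<open>\<Omega>\<close> although \<open>p'\<close> lies
      in its closure.\<close>
    moreover have "\<not> \<phi> p' < 0"
    proof
      assume lt: "\<phi> p' < 0"
      have "open ({x. \<phi> x < 0} \<inter> ball p r)"
        by (intro open_Int open_ball open_Collect_less cont continuous_on_const)
      moreover have "p' \<in> {x. \<phi> x < 0} \<inter> ball p r" using lt that by auto
      moreover have "p' \<in> closure \<Omega>" using that by (simp add: frontier_def)
      ultimately obtain x where "x \<in> \<Omega>" "x \<in> {x. \<phi> x < 0} \<inter> ball p r"
        using open_Int_closure_eq_empty[of "{x. \<phi> x < 0} \<inter> ball p r" \<Omega>] by blast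
      then show False using \<Omega>_iff[of x] by auto
    qed
    ultimately show ?thesis by simp
  qed
  \<comment> \<open>With Lipschitz constant \<open>1 + 2 * M\<close>, the height
    \<open>\<phi>\<close> varies by less than \<open>\<rho>/4\<close> within radius
    \<open>\<kappa> * \<rho>\<close>, half of its size \<open>\<rho>/2\<close> at the
    centre.\<close>
  define \<kappa> where "\<kappa> = 1 / (4 * (1 + 2 * M))"
  have \<kappa>: "0 < \<kappa>" "\<kappa> \<le> 1/4" "(1 + 2 * M) * \<kappa> = 1/4" using M0 by (auto simp: \<kappa>_def field_simps)
  \<comment> \<open>The sign \<open>\<sigma>\<close> treats the interior and the exterior centre at
    once.\<close>
  have main: "y \<in> ball p' \<rho> \<and> \<bar>\<phi> y - \<sigma> * (\<rho>/2)\<bar> < \<rho>/4 \<and> y \<in> ball p r"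
    if p': "p' \<in> frontier \<Omega>" "p' \<in> ball p (r/2)" and \<rho>: "0 < \<rho>" "\<rho> \<le> r/2"
      and \<sigma>: "\<bar>\<sigma>\<bar> = 1" and y: "y \<in> ball (p' + (\<sigma> * (\<rho>/2)) *\<^sub>R e) (\<kappa> * \<rho>)" for p' \<rho> \<sigma> y
  proof -
    define q where "q = p' + (\<sigma> * (\<rho>/2)) *\<^sub>R e"
    have qp: "dist p' q = \<rho>/2" using e \<sigma> \<rho> by (simp add: q_def dist_norm abs_mult)
    have yq: "dist q y < \<kappa> * \<rho>" using y by (simp add: q_def)
    also have "\<kappa> * \<rho> \<le> 1/4 * \<rho>" using \<kappa> \<rho> by (intro mult_right_mono) auto
    finally have yq4: "dist q y < \<rho>/4" by simp
    have y1: "dist p' y < \<rho>" using qp yq4 dist_triangle[of p' y q] \<rho> by simp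
    have pp: "dist p p' < r/2" using p' by simp
    have y2: "y \<in> ball p r" using y1 pp \<rho> dist_triangle[of p y p'] by simp
    have q2: "q \<in> ball p r" using qp pp \<rho> dist_triangle[of p q p'] by simp
    have "\<phi> q = \<sigma> * (\<rho>/2)" using \<phi>e \<phi>0[OF p'(1)] pp r by (simp add: q_def)
    then have "\<bar>\<phi> y - \<sigma> * (\<rho>/2)\<bar> \<le> (1 + 2 * M) * norm (y - q)" using \<phi>M[OF y2 q2] by simp
    also have "\<dots> < (1 + 2 * M) * (\<kappa> * \<rho>)"
      using yq M0 by (intro mult_strict_left_mono) (auto simp: dist_norm norm_minus_commute)
    also have "\<dots> = \<rho>/4" using \<kappa>(3) by (metis mult.assoc mult.commute mult.right_neutral times_divide_eq_right)
    finally show ?thesis using y1 y2 by simp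
  qed
  show ?thesis
  \<comment> \<open>Restricting both frontier points and scales to \<open>r/2\<close> keeps every
    \<open>ball p' \<rho>\<close> inside \<open>ball p r\<close>, where the graph describes
    \<open>\<Omega>\<close>.\<close>
  proof (rule that[of \<kappa> "r/2"])
    show "0 < \<kappa>" "0 < r/2" using \<kappa> r by auto
    show "(\<exists>q. ball q (\<kappa> * \<rho>) \<subseteq> ball p' \<rho> \<inter> \<Omega>) \<and> (\<exists>q. ball q (\<kappa> * \<rho>) \<subseteq> ball p' \<rho> \<inter> - \<Omega>)"
      if "p' \<in> frontier \<Omega>" "p' \<in> ball p (r/2)" "0 < \<rho>" "\<rho> \<le> r/2" for p' \<rho>
    proof (intro conjI exI subsetI)
      fix y assume "y \<in> ball (p' + (1 * (\<rho>/2)) *\<^sub>R e) (\<kappa> * \<rho>)"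
      from main[OF that _ this] have "y \<in> ball p' \<rho>" "\<bar>\<phi> y - \<rho>/2\<bar> < \<rho>/4" "y \<in> ball p r" by simp_all
      moreover from this(2) that(3) have "\<phi> y > 0" by linarith
      ultimately show "y \<in> ball p' \<rho> \<inter> \<Omega>" using \<Omega>_iff by blast
    next
      fix y assume "y \<in> ball (p' + (-1 * (\<rho>/2)) *\<^sub>R e) (\<kappa> * \<rho>)"
      from main[OF that _ this] have "y \<in> ball p' \<rho>" "\<bar>\<phi> y + \<rho>/2\<bar> < \<rho>/4" "y \<in> ball p r" by simp_all
      moreover from this(2) that(3) have "\<not> \<phi> y > 0" by linarith
      ultimately show "y \<in> ball p' \<rho> \<inter> - \<Omega>" using \<Omega>_iff by blast
    qed
    have "frontier \<Omega> \<inter> ball p (r/2) \<subseteq> (\<lambda>x. x + g x *\<^sub>R e) ` {x. e \<bullet> x = 0}"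
    proof
      fix x assume x: "x \<in> frontier \<Omega> \<inter> ball p (r/2)"
      then have "\<phi> x = 0" using \<phi>0[of x] r by auto
      then have "x = P x + g (P x) *\<^sub>R e" by (simp add: \<phi>_def P_def)
      moreover have "e \<bullet> P x = 0" by (simp add: P_def inner_diff_right ee inner_commute)
      ultimately show "x \<in> (\<lambda>x. x + g x *\<^sub>R e) ` {x. e \<bullet> x = 0}" by blast
    qed
    moreover have "negligible ((\<lambda>x. x + g x *\<^sub>R e) ` {x. e \<bullet> x = 0})"
    proof (rule negligible_differentiable_image_negligible)
      show "negligible {x. e \<bullet> x = 0}" using e by (intro negligible_hyperplane) auto
      have "g differentiable (at x within {x. e \<bullet> x = 0})" for x
        using g by (meson differentiable_at_withinI differentiable_def)
      then show "(\<lambda>x. x + g x *\<^sub>R e) differentiable_on {x. e \<bullet> x = 0}"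
        unfolding differentiable_on_def by (intro ballI derivative_intros) auto
    qed simp
    ultimately show "negligible (frontier \<Omega> \<inter> ball p (r/2))" by (rule negligible_subset[rotated])
  qed
qed

text \<open>The frontier is compact, so finitely many local neighbourhoods cover it and the minima
  of their constants work everywhere; decreasing \<open>\<kappa>\<close> only shrinks the corkscrew
  balls.\<close>

lemma C11_corkscrew:
  fixes \<Omega> :: "'a::euclidean_space set"
  assumes "open \<Omega>" "bounded \<Omega>" "C11_boundary \<Omega>"
  obtains \<kappa> r where "0 < \<kappa>" "0 < r" "corkscrew \<kappa> r \<Omega>" "corkscrew \<kappa> r (- \<Omega>)"
    "negligible (frontier \<Omega>)"
proof -
  have "\<forall>p\<in>frontier \<Omega>. \<exists>\<kappa> R. 0 < \<kappa> \<and> 0 < R \<and> negligible (frontier \<Omega> \<inter> ball p R) \<and>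
      (\<forall>p'\<in>frontier \<Omega> \<inter> ball p R. \<forall>\<rho>. 0 < \<rho> \<longrightarrow> \<rho> \<le> R \<longrightarrow>
       (\<exists>q. ball q (\<kappa> * \<rho>) \<subseteq> ball p' \<rho> \<inter> \<Omega>) \<and> (\<exists>q. ball q (\<kappa> * \<rho>) \<subseteq> ball p' \<rho> \<inter> - \<Omega>))"
  proof
    fix p assume "p \<in> frontier \<Omega>"
    from corkscrew_local[OF assms(1,3) this] obtain \<kappa> R where "0 < \<kappa>" "0 < R"
      "negligible (frontier \<Omega> \<inter> ball p R)"
      and *: "\<And>p' \<rho>. p' \<in> frontier \<Omega> \<Longrightarrow> p' \<in> ball p R \<Longrightarrow> 0 < \<rho> \<Longrightarrow> \<rho> \<le> R \<Longrightarrow>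
       (\<exists>q. ball q (\<kappa> * \<rho>) \<subseteq> ball p' \<rho> \<inter> \<Omega>) \<and> (\<exists>q. ball q (\<kappa> * \<rho>) \<subseteq> ball p' \<rho> \<inter> - \<Omega>)"
      by blast
    then show "\<exists>\<kappa> R. 0 < \<kappa> \<and> 0 < R \<and> negligible (frontier \<Omega> \<inter> ball p R) \<and>
      (\<forall>p'\<in>frontier \<Omega> \<inter> ball p R. \<forall>\<rho>. 0 < \<rho> \<longrightarrow> \<rho> \<le> R \<longrightarrow>
       (\<exists>q. ball q (\<kappa> * \<rho>) \<subseteq> ball p' \<rho> \<inter> \<Omega>) \<and> (\<exists>q. ball q (\<kappa> * \<rho>) \<subseteq> ball p' \<rho> \<inter> - \<Omega>))"
      by (intro exI[of _ \<kappa>] exI[of _ R] conjI ballI allI impI; (elim IntE)?; (rule * | assumption | blast)+)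
  qed
  then obtain \<kappa> R where "\<forall>p\<in>frontier \<Omega>. 0 < \<kappa> p \<and> 0 < R p \<and>
      negligible (frontier \<Omega> \<inter> ball p (R p)) \<and>
      (\<forall>p'\<in>frontier \<Omega> \<inter> ball p (R p). \<forall>\<rho>. 0 < \<rho> \<longrightarrow> \<rho> \<le> R p \<longrightarrow>
       (\<exists>q. ball q (\<kappa> p * \<rho>) \<subseteq> ball p' \<rho> \<inter> \<Omega>) \<and> (\<exists>q. ball q (\<kappa> p * \<rho>) \<subseteq> ball p' \<rho> \<inter> - \<Omega>))"
    unfolding bchoice_iff by blast
  then have H: "\<And>p. p \<in> frontier \<Omega> \<Longrightarrow> 0 < \<kappa> p \<and> 0 < R p \<and>
      negligible (frontier \<Omega> \<inter> ball p (R p)) \<and>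
      (\<forall>p'\<in>frontier \<Omega> \<inter> ball p (R p). \<forall>\<rho>. 0 < \<rho> \<longrightarrow> \<rho> \<le> R p \<longrightarrow>
       (\<exists>q. ball q (\<kappa> p * \<rho>) \<subseteq> ball p' \<rho> \<inter> \<Omega>) \<and> (\<exists>q. ball q (\<kappa> p * \<rho>) \<subseteq> ball p' \<rho> \<inter> - \<Omega>))"
    by blast
  have "compact (frontier \<Omega>)" using assms(2) by (rule compact_frontier_bounded)
  moreover have "frontier \<Omega> \<subseteq> (\<Union>p\<in>frontier \<Omega>. ball p (R p))" using H by auto
  ultimately obtain T where T: "T \<subseteq> frontier \<Omega>" "finite T" "frontier \<Omega> \<subseteq> (\<Union>p\<in>T. ball p (R p))"
    using compactE_image[of "frontier \<Omega>" "frontier \<Omega>" "\<lambda>p. ball p (R p)"] open_ball by metis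
  \<comment> \<open>The extra 1 keeps \<open>Min\<close> meaningful when \<open>T\<close> is empty,
    as happens for empty \<open>\<Omega>\<close>.\<close>
  define \<kappa>0 where "\<kappa>0 = Min (insert 1 (\<kappa> ` T))"
  define r where "r = Min (insert 1 (R ` T))"
  have \<kappa>0: "0 < \<kappa>0" "p \<in> T \<Longrightarrow> \<kappa>0 \<le> \<kappa> p" for p
    unfolding \<kappa>0_def using T H by (auto intro!: Min_le)
  have r: "0 < r" "p \<in> T \<Longrightarrow> r \<le> R p" for p
    unfolding r_def using T H by (auto intro!: Min_le)
  have main: "(\<exists>q. ball q (\<kappa>0 * \<rho>) \<subseteq> ball p' \<rho> \<inter> \<Omega>) \<and> (\<exists>q. ball q (\<kappa>0 * \<rho>) \<subseteq> ball p' \<rho> \<inter> - \<Omega>)"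
    if "p' \<in> frontier \<Omega>" "0 < \<rho>" "\<rho> \<le> r" for p' \<rho>
  proof -
    have "p' \<in> (\<Union>p\<in>T. ball p (R p))" using T(3) that(1) by blast
    then obtain p where p: "p \<in> T" "p' \<in> ball p (R p)" by blast
    then have "(\<exists>q. ball q (\<kappa> p * \<rho>) \<subseteq> ball p' \<rho> \<inter> \<Omega>) \<and> (\<exists>q. ball q (\<kappa> p * \<rho>) \<subseteq> ball p' \<rho> \<inter> - \<Omega>)"
      using H[of p] T r(2)[of p] that by auto
    moreover have "ball q (\<kappa>0 * \<rho>) \<subseteq> ball q (\<kappa> p * \<rho>)" for q
      using \<kappa>0(2)[OF p(1)] that by (intro subset_ball mult_right_mono) auto
    ultimately show ?thesis by (meson subset_trans)
  qed
  have "frontier \<Omega> = (\<Union>p\<in>T. frontier \<Omega> \<inter> ball p (R p))" using T by blast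
  moreover have "negligible (\<Union>p\<in>T. frontier \<Omega> \<inter> ball p (R p))"
    using T H by (intro negligible_Union) auto
  ultimately have "negligible (frontier \<Omega>)" by simp
  then show ?thesis using that[of \<kappa>0 r] \<kappa>0 r main unfolding corkscrew_def by simp
qed

section \<open>Radial integrals\<close>

text \<open>Polar coordinates for radial functions. Both measures give \<open>{..a}\<close> the
  volume of the ball of radius \<open>a\<close>, on the right by integrating the derivative of that
  volume, and such half-lines form an intersection-stable generator of the Borel sets.\<close>

lemma distr_norm_lborel:
  fixes x :: "'a::euclidean_space"
  defines "n \<equiv> DIM('a)"
  shows "distr lborel borel (\<lambda>y. norm (y - x)) =
    density lborel (\<lambda>t. ennreal (real n * unit_ball_vol (real n) * t ^ (n - 1)) * indicator {0..} t)"
    (is "?L = ?R")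
proof (rule measure_eqI_generator_eq[where E = "range atMost" and \<Omega> = UNIV and A = "\<lambda>i. {..real i}"])
  show "Int_stable (range atMost :: real set set)" by (auto simp: Int_stable_def)
  have "sets borel = sigma_sets UNIV (range atMost :: real set set)"
    by (subst borel_eq_atMost) (simp add: sets_measure_of)
  then show "sets ?L = sigma_sets UNIV (range atMost)" "sets ?R = sigma_sets UNIV (range atMost)" by auto
  show "(\<Union>i. {..real i}) = UNIV" using real_arch_simple by auto
  have n: "n > 0" by (simp add: n_def)
  have L: "emeasure ?L {..a} = (if 0 \<le> a then ennreal (unit_ball_vol (real n) * a ^ n) else 0)" for a
  proof -
    have "emeasure ?L {..a} = emeasure lborel (cball x a)"
      by (subst emeasure_distr) (auto simp: vimage_def cball_def dist_norm norm_minus_commute)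
    then show ?thesis using emeasure_cball[of a x] by (auto simp: n_def)
  qed
  show "emeasure ?L {..real i} \<noteq> \<infinity>" for i by (simp add: L)
  fix X assume "X \<in> range (atMost :: real \<Rightarrow> real set)"
  then obtain a where X: "X = {..a}" by auto
  have "emeasure ?R X = (\<integral>\<^sup>+t. ennreal (real n * unit_ball_vol (real n) * t ^ (n - 1)) * indicator {0..a} t \<partial>lborel)"
    unfolding X by (subst emeasure_density) (auto intro!: nn_integral_cong simp: indicator_def)
  also have "\<dots> = (if 0 \<le> a then ennreal (unit_ball_vol (real n) * a ^ n) else 0)"
  proof (cases "0 \<le> a")
    case True
    have "(\<integral>\<^sup>+t. ennreal (real n * unit_ball_vol (real n) * t ^ (n - 1)) * indicator {0..a} t \<partial>lborel)
        = ennreal (unit_ball_vol (real n) * a ^ n - unit_ball_vol (real n) * 0 ^ n)"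
      using True by (intro nn_integral_FTC_Icc) (auto intro!: derivative_eq_intros)
    then show ?thesis using True n by simp
  qed simp
  finally show "emeasure ?L X = emeasure ?R X" by (simp add: L X)
qed auto

lemma nn_integral_radial:
  fixes x :: "'a::euclidean_space" and f :: "real \<Rightarrow> ennreal"
  assumes [measurable]: "f \<in> borel_measurable borel"
  shows "(\<integral>\<^sup>+y. f (norm (y - x)) \<partial>lborel) =
    (\<integral>\<^sup>+t. ennreal (real DIM('a) * unit_ball_vol (real DIM('a)) * t ^ (DIM('a) - 1)) * indicator {0..} t * f t \<partial>lborel)"
proof -
  have "(\<integral>\<^sup>+y. f (norm (y - x)) \<partial>lborel) = (\<integral>\<^sup>+t. f t \<partial>distr lborel borel (\<lambda>y. norm (y - x)))"
    by (subst nn_integral_distr) auto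
  then show ?thesis by (simp add: distr_norm_lborel nn_integral_density)
qed

lemma power_times_powr_dim:
  fixes t :: real
  assumes "t > 0"
  shows "t ^ (DIM('a::euclidean_space) - 1) * t powr (b - real DIM('a)) = t powr (b - 1)"
proof -
  have "t ^ (DIM('a) - 1) = t powr (real DIM('a) - 1)"
    using assms by (simp add: powr_realpow[symmetric] of_nat_diff)
  then show ?thesis by (simp add: powr_add[symmetric])
qed

text \<open>With \<open>a = 2 * s\<close> this is the tail of the fractional kernel. The Jacobian
  leaves \<open>t powr (- a - 1)\<close>, which has a primitive vanishing at infinity.\<close>

lemma nn_integral_powr_outside:
  fixes x :: "'a::euclidean_space"
  assumes "\<rho> > 0" "a > 0"
  shows "(\<integral>\<^sup>+y. ennreal (norm (y - x) powr (- a - real DIM('a))) * indicator {y. \<rho> \<le> norm (y - x)} y \<partial>lborel)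
     = ennreal (real DIM('a) * unit_ball_vol (real DIM('a)) / a * \<rho> powr (- a))"
proof -
  let ?c = "real DIM('a) * unit_ball_vol (real DIM('a))"
  have "(\<integral>\<^sup>+y. ennreal (norm (y - x) powr (- a - real DIM('a))) * indicator {y. \<rho> \<le> norm (y - x)} y \<partial>lborel)
     = (\<integral>\<^sup>+y. (\<lambda>t. ennreal (t powr (- a - real DIM('a))) * indicator {\<rho>..} t) (norm (y - x)) \<partial>lborel)"
    by (intro nn_integral_cong) (auto simp: indicator_def)
  also have "\<dots> = (\<integral>\<^sup>+t. ennreal (?c * t powr (- a - 1)) * indicator {\<rho>..} t \<partial>lborel)"
    apply (subst nn_integral_radial)
     apply measurable
    apply (intro nn_integral_cong)
    subgoal for t
      using power_times_powr_dim[of t "- a", where 'a = 'a] assms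
      by (auto simp: indicator_def ennreal_mult[symmetric] mult.assoc)
    done
  also have "\<dots> = ennreal (0 - (- ?c / a * \<rho> powr (- a)))"
  proof (rule nn_integral_FTC_atLeast)
    have "((\<lambda>t. t powr (- a)) \<longlongrightarrow> 0) at_top"
      using assms by (intro tendsto_neg_powr filterlim_ident) auto
    then show "((\<lambda>t. - ?c / a * t powr (- a)) \<longlongrightarrow> 0) at_top"
      by (metis tendsto_mult_right_zero)
    show "((\<lambda>t. - ?c / a * t powr (- a)) has_real_derivative ?c * t powr (- a - 1)) (at t)"
      if "\<rho> \<le> t" for t
      using assms that by (auto intro!: derivative_eq_intros simp: field_simps)
  qed (auto simp: assms)
  finally show ?thesis by simp
qed

text \<open>The exponent is critical: the Jacobian leaves \<open>1 / t\<close>. This is the source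
  of the logarithm in the upper bound for the kernel.\<close>

lemma nn_integral_powr_annulus:
  fixes x :: "'a::euclidean_space"
  assumes "\<rho> > 0" "\<rho> \<le> R"
  shows "(\<integral>\<^sup>+y. ennreal (norm (y - x) powr (- real DIM('a))) * indicator {y. \<rho> \<le> norm (y - x) \<and> norm (y - x) \<le> R} y \<partial>lborel)
     = ennreal (real DIM('a) * unit_ball_vol (real DIM('a)) * (ln R - ln \<rho>))"
proof -
  let ?c = "real DIM('a) * unit_ball_vol (real DIM('a))"
  have "(\<integral>\<^sup>+y. ennreal (norm (y - x) powr (- real DIM('a))) * indicator {y. \<rho> \<le> norm (y - x) \<and> norm (y - x) \<le> R} y \<partial>lborel)
     = (\<integral>\<^sup>+y. (\<lambda>t. ennreal (t powr (- real DIM('a))) * indicator {\<rho>..R} t) (norm (y - x)) \<partial>lborel)"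
    by (intro nn_integral_cong) (auto simp: indicator_def)
  also have "\<dots> = (\<integral>\<^sup>+t. ennreal (?c * t powr (- 1)) * indicator {\<rho>..R} t \<partial>lborel)"
    apply (subst nn_integral_radial)
     apply measurable
    apply (intro nn_integral_cong)
    subgoal for t
      using power_times_powr_dim[of t 0, where 'a = 'a] assms
      by (auto simp: indicator_def ennreal_mult[symmetric] mult.assoc)
    done
  also have "\<dots> = ennreal (?c * ln R - ?c * ln \<rho>)"
    using assms by (intro nn_integral_FTC_Icc) (auto intro!: derivative_eq_intros simp: powr_minus field_simps)
  finally show ?thesis by (simp add: algebra_simps)
qed

text \<open>Subcritical singularities are integrable; this controls the Taylor remainder times the
  kernel near \<open>x\<close>.\<close>

lemma nn_integral_powr_ball_finite:
  fixes x :: "'a::euclidean_space"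
  assumes "a > 0" "R \<ge> 0"
  shows "(\<integral>\<^sup>+y. ennreal (norm (y - x) powr (a - real DIM('a))) * indicator (ball x R) y \<partial>lborel) < \<infinity>"
proof -
  let ?c = "real DIM('a) * unit_ball_vol (real DIM('a))"
  have "(\<integral>\<^sup>+y. ennreal (norm (y - x) powr (a - real DIM('a))) * indicator (ball x R) y \<partial>lborel)
     \<le> (\<integral>\<^sup>+y. (\<lambda>t. ennreal (t powr (a - real DIM('a))) * indicator {0..R} t) (norm (y - x)) \<partial>lborel)"
    by (intro nn_integral_mono) (auto simp: indicator_def dist_norm norm_minus_commute)
  also have "\<dots> = (\<integral>\<^sup>+t. ennreal (?c * t powr (a - 1)) * indicator {0..R} t \<partial>lborel)"
    apply (subst nn_integral_radial)
     apply measurable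
    apply (intro nn_integral_cong)
    subgoal for t
      using power_times_powr_dim[of t a, where 'a = 'a] assms
      \<comment> \<open>At \<open>t = 0\<close> both sides vanish since
        \<open>0 powr b = 0\<close>.\<close>
      by (cases "t = 0") (auto simp: indicator_def ennreal_mult[symmetric] mult.assoc)
    done
  also have "\<dots> = ennreal (?c * (R powr a / a))"
    using has_integral_mult_right[OF has_integral_powr_from_0[of "a - 1" R], of ?c] assms
    by (intro nn_integral_has_integral_lebesgue') auto
  also have "\<dots> < \<infinity>" by simp
  finally show ?thesis .
qed

section \<open>The kernel on domains with corkscrews\<close>

lemma frac_kernel_powr:
  "frac_kernel s x y = norm (x - y) powr (- (real DIM('a) + 2 * s))" for x y :: "'a::euclidean_space"
  by (simp only: frac_kernel_def powr_minus_divide)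

lemma frac_kernel_commute: "frac_kernel s x y = frac_kernel s y x"
  by (simp add: frac_kernel_def norm_minus_commute)

lemma frac_kernel_nonneg [simp]: "0 \<le> frac_kernel s x y"
  by (simp add: frac_kernel_def)

lemma frac_kernel_measurable [measurable (raw)]:
  assumes [measurable]: "f \<in> borel_measurable M" "g \<in> borel_measurable M"
  shows "(\<lambda>z. frac_kernel s (f z) (g z)) \<in> borel_measurable M"
  unfolding frac_kernel_def by measurable

lemma frac_kernel_le:
  fixes x y :: "'a::euclidean_space"
  assumes "0 \<le> s" "0 < a" "a \<le> norm (x - y)"
  shows "frac_kernel s x y \<le> a powr (- (real DIM('a) + 2 * s))"
  unfolding frac_kernel_powr using assms by (intro powr_mono2') auto

text \<open>The diagonal is excluded because \<open>frac_kernel s x x\<close> has the formal value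
  0.\<close>

lemma frac_kernel_ge:
  fixes x y :: "'a::euclidean_space"
  assumes "0 \<le> s" "x \<noteq> y" "norm (x - y) \<le> b"
  shows "b powr (- (real DIM('a) + 2 * s)) \<le> frac_kernel s x y"
  unfolding frac_kernel_powr using assms by (intro powr_mono2') auto

lemma nn_integral_frac_kernel_outside:
  fixes x :: "'a::euclidean_space"
  assumes "0 < s" "0 < \<rho>"
  shows "(\<integral>\<^sup>+y. ennreal (frac_kernel s x y) * indicator {y. \<rho> \<le> norm (y - x)} y \<partial>lborel)
     = ennreal (real DIM('a) * unit_ball_vol (real DIM('a)) / (2 * s) * \<rho> powr (- (2 * s)))"
proof -
  have "frac_kernel s x y = norm (y - x) powr (- (2 * s) - real DIM('a))" for y
  proof -
    have "- (real DIM('a) + 2 * s) = - (2 * s) - real DIM('a)" by simp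
    then show ?thesis by (simp only: frac_kernel_powr norm_minus_commute[of x y])
  qed
  then show ?thesis using nn_integral_powr_outside[of \<rho> "2 * s" x] assms by simp
qed

lemma infdist_closure: "infdist z (closure A) = infdist z A" for A :: "'a::euclidean_space set"
  by (simp add: infdist_eq_setdist setdist_closure_2)

text \<open>A nearest point \<open>p\<close> of the closure exists. If it lies in \<open>A\<close>
  while \<open>z\<close> is outside the closure, the segment from \<open>z\<close> to
  \<open>p\<close> meets the frontier at some \<open>q\<close>, and minimality of the distance
  forces \<open>q = p\<close>.\<close>

lemma infdist_attained_frontier:
  fixes A :: "'a::euclidean_space set"
  assumes "A \<noteq> {}"
  obtains p where "p \<in> closure A" "dist z p = infdist z A" "z \<notin> closure A \<Longrightarrow> p \<in> frontier A"
proof -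
  have "closed (closure A)" "closure A \<noteq> {}" using assms by auto
  then obtain p where p: "p \<in> closure A" "infdist z (closure A) = dist z p"
    by (metis infdist_attains_inf)
  have "p \<in> frontier A" if "z \<notin> closure A"
  proof (cases "p \<in> A")
    case False
    then show ?thesis using p(1) interior_subset by (auto simp: frontier_def)
  next
    case True
    have "z \<notin> A" using that closure_subset by auto
    then have "closed_segment z p \<inter> frontier A \<noteq> {}"
      using True by (intro connected_Int_frontier) auto
    then obtain q where q: "q \<in> closed_segment z p" "q \<in> frontier A" by blast
    then have "infdist z (closure A) \<le> dist z q" by (intro infdist_le) (auto simp: frontier_def)
    moreover have "dist z p = dist z q + dist q p"
      using q(1) between_mem_segment[of z p q] between[of z p q] by simp
    ultimately have "q = p" using p(2) by simp
    then show ?thesis using q by simp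
  qed
  then show ?thesis using that p by (simp add: infdist_closure)
qed

section \<open>The exterior weight and its two-sided bounds\<close>

locale corkscrew_domain =
  fixes \<Omega> :: "'a::euclidean_space set" and s \<kappa> r :: real
  assumes open_dom: "open \<Omega>" and bounded_dom: "bounded \<Omega>" and nonempty: "\<Omega> \<noteq> {}"
    and s_pos: "0 < s" and \<kappa>_pos: "0 < \<kappa>" and r_pos: "0 < r"
    and inner: "corkscrew \<kappa> r \<Omega>" and outer: "corkscrew \<kappa> r (- \<Omega>)"
    and frontier_null: "negligible (frontier \<Omega>)"
begin

abbreviation K :: "'a \<Rightarrow> 'a \<Rightarrow> real" where "K \<equiv> frac_kernel s"
abbreviation d :: "'a \<Rightarrow> real" where "d z \<equiv> infdist z \<Omega>"

definition N :: "'a \<Rightarrow> real" where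
  "N z = (LINT w : \<Omega> | lebesgue. K z w)"

lemma \<nu>_pos: "0 < real DIM('a) + 2 * s" and n_pos: "0 < real DIM('a)" and \<omega>_pos: "0 < unit_ball_vol (real DIM('a))"
  using s_pos by (auto intro!: unit_ball_vol_pos add_pos_pos)

lemma dom_sets [measurable]: "\<Omega> \<in> sets borel" "closure \<Omega> \<in> sets borel" using open_dom by auto

lemma d_pos: "z \<notin> closure \<Omega> \<Longrightarrow> 0 < d z"
  using in_closure_iff_infdist_zero[OF nonempty, of z] infdist_nonneg[of z \<Omega>] by auto

lemma d_le: "y \<in> closure \<Omega> \<Longrightarrow> d z \<le> norm (z - y)"
  using infdist_le[of y "closure \<Omega>" z] by (simp add: infdist_closure dist_norm)

text \<open>The integrand is Borel, so completion leaves the integral unchanged, and over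
  \<open>lborel\<close> measurability in a parameter and Fubini become available.\<close>

lemma N_lborel: "N z = (\<integral>w. indicator \<Omega> w * K z w \<partial>lborel)"
  unfolding N_def set_lebesgue_integral_def by (subst integral_completion) simp_all

lemma N_measurable [measurable]: "N \<in> borel_measurable borel"
proof -
  have "(\<lambda>z. \<integral>w. indicator \<Omega> w * K z w \<partial>lborel) \<in> borel_measurable borel"
    by (intro lborel.borel_measurable_lebesgue_integral) measurable
  then show ?thesis by (simp add: N_lborel[abs_def])
qed

text \<open>Every point of \<open>\<Omega>\<close> has distance at least \<open>d z\<close> from
  \<open>z\<close>, so the radial tail dominates.\<close>

lemma nn_N_le:
  assumes "z \<notin> closure \<Omega>"
  shows "(\<integral>\<^sup>+w. ennreal (indicator \<Omega> w * K z w) \<partial>lborel) \<le> ennreal (real DIM('a) * unit_ball_vol (real DIM('a)) / (2 * s) * d z powr (- (2 * s)))"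
proof -
  have "(\<integral>\<^sup>+w. ennreal (indicator \<Omega> w * K z w) \<partial>lborel)
      \<le> (\<integral>\<^sup>+w. ennreal (K z w) * indicator {w. d z \<le> norm (w - z)} w \<partial>lborel)"
    using d_le closure_subset
    by (intro nn_integral_mono) (force simp: indicator_def norm_minus_commute)
  then show ?thesis using nn_integral_frac_kernel_outside[OF s_pos d_pos[OF assms], of z] by simp
qed

lemma kernel_integrable:
  assumes "z \<notin> closure \<Omega>"
  shows "integrable lborel (\<lambda>w. indicator \<Omega> w * K z w)"
proof (rule integrableI_bounded)
  show "(\<integral>\<^sup>+w. ennreal (norm (indicator \<Omega> w * K z w)) \<partial>lborel) < \<infinity>"
    using nn_N_le[OF assms] by (simp add: le_less_trans[OF _ ennreal_less_top])
qed measurable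

lemma nn_N:
  assumes "z \<notin> closure \<Omega>"
  shows "(\<integral>\<^sup>+w. ennreal (indicator \<Omega> w * K z w) \<partial>lborel) = ennreal (N z)"
  unfolding N_lborel by (intro nn_integral_eq_integral kernel_integrable assms) simp

lemma N_nonneg [simp]: "0 \<le> N z"
  unfolding N_lborel by (intro integral_nonneg_AE) simp

lemma N_le:
  assumes "z \<notin> closure \<Omega>"
  shows "N z \<le> real DIM('a) * unit_ball_vol (real DIM('a)) / (2 * s) * d z powr (- (2 * s))"
  using nn_N_le[OF assms] s_pos \<omega>_pos unfolding nn_N[OF assms] by (subst (asm) ennreal_le_iff) auto

text \<open>Restricts the integral to one ball and bounds the kernel there by its value at distance
  \<open>b\<close>.\<close>

lemma N_ge_ball:
  assumes z: "z \<notin> closure \<Omega>" and q: "ball q a \<subseteq> \<Omega>" "0 \<le> a"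
    and b: "\<And>w. w \<in> ball q a \<Longrightarrow> norm (z - w) \<le> b"
  shows "b powr (- (real DIM('a) + 2 * s)) * (unit_ball_vol (real DIM('a)) * a ^ DIM('a)) \<le> N z"
proof -
  have "b powr (- (real DIM('a) + 2 * s)) * (unit_ball_vol (real DIM('a)) * a ^ DIM('a)) = (\<integral>w. b powr (- (real DIM('a) + 2 * s)) * indicator (ball q a) w \<partial>lborel)"
    using q by (simp add: content_ball)
  also have "\<dots> \<le> (\<integral>w. indicator \<Omega> w * K z w \<partial>lborel)"
  proof (intro integral_mono kernel_integrable z)
    show "integrable lborel (\<lambda>w. b powr (- (real DIM('a) + 2 * s)) * indicator (ball q a) w :: real)"
      by (intro integrable_mult_right integrable_real_indicator emeasure_lborel_ball_finite) simp
    fix w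
    show "b powr (- (real DIM('a) + 2 * s)) * indicator (ball q a) w \<le> indicator \<Omega> w * K z w"
    proof (cases "w \<in> ball q a")
      case True
      then have "w \<in> \<Omega>" using q by auto
      moreover have "z \<noteq> w" using \<open>w \<in> \<Omega>\<close> z closure_subset by blast
      ultimately show ?thesis using True b[OF True] frac_kernel_ge[of s z w b] s_pos by simp
    qed simp
  qed
  finally show ?thesis by (simp add: N_lborel)
qed

text \<open>The normalization \<open>1 \<le> D\<close> makes \<open>ln D\<close> nonnegative, which
  the lower bound on the kernel uses for points at distance at least 1 from the complement.\<close>

lemma diam_bound:
  obtains D where "1 \<le> D" "\<And>a b. a \<in> closure \<Omega> \<Longrightarrow> b \<in> closure \<Omega> \<Longrightarrow> dist a b \<le> D"
proof -
  have "bounded (closure \<Omega>)" using bounded_dom by (rule bounded_closure)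
  then obtain D where "\<forall>a\<in>closure \<Omega>. \<forall>b\<in>closure \<Omega>. dist a b \<le> D" by (auto simp: bounded_two_points)
  then show ?thesis by (intro that[of "max D 1"]) (auto intro: max.coboundedI1)
qed

text \<open>Up to distance \<open>r\<close> the corkscrew ball at scale \<open>d z\<close> near a
  nearest frontier point gives the order \<open>d z powr (- (2 * s))\<close>; farther out a fixed
  ball in \<open>\<Omega>\<close> gives the decay of the kernel itself. Reciprocals are recorded
  because \<open>N\<close> enters the Neumann kernel as a denominator.\<close>

lemma N_lower:
  obtains C where "0 < C"
    "\<And>z. z \<notin> closure \<Omega> \<Longrightarrow> 0 < N z"
    "\<And>z. z \<notin> closure \<Omega> \<Longrightarrow> d z \<le> r \<Longrightarrow> 1 / N z \<le> C * d z powr (2 * s)"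
    "\<And>z. z \<notin> closure \<Omega> \<Longrightarrow> r < d z \<Longrightarrow> 1 / N z \<le> C * d z powr (real DIM('a) + 2 * s)"
proof -
  obtain D where D1: "1 \<le> D" and D2: "\<And>a b. a \<in> closure \<Omega> \<Longrightarrow> b \<in> closure \<Omega> \<Longrightarrow> dist a b \<le> D"
    by (rule diam_bound) blast
  have D: "0 < D" using D1 by simp
  obtain q0 a0 where q0: "0 < a0" "ball q0 a0 \<subseteq> \<Omega>"
    using open_dom nonempty by (metis ex_in_conv open_contains_ball)
  \<comment> \<open>The base 2 arises because a corkscrew ball inside \<open>ball p (d z)\<close>,
    with \<open>p\<close> nearest to \<open>z\<close>, lies within \<open>2 * d z\<close> of
    \<open>z\<close>.\<close>
  define c1 where "c1 = 2 powr (- (real DIM('a) + 2 * s)) * (unit_ball_vol (real DIM('a)) * \<kappa> ^ DIM('a))"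
  \<comment> \<open>For \<open>r < d z\<close> all points of \<open>\<Omega>\<close> are within
    \<open>d z + D \<le> (1 + D / r) * d z\<close> of \<open>z\<close>.\<close>
  define c2 where "c2 = (1 + D / r) powr (- (real DIM('a) + 2 * s)) * (unit_ball_vol (real DIM('a)) * a0 ^ DIM('a))"
  have c1: "0 < c1" using \<omega>_pos \<kappa>_pos by (simp add: c1_def)
  have "0 < 1 + D / r" using D r_pos by (simp add: add_pos_pos)
  then have c2: "0 < c2" using \<omega>_pos q0 by (simp add: c2_def)
  have near: "c1 * d z powr (- (2 * s)) \<le> N z" if z: "z \<notin> closure \<Omega>" and dr: "d z \<le> r" for z
  proof -
    have dz: "0 < d z" using d_pos[OF z] .
    obtain p where p: "dist z p = d z" "p \<in> frontier \<Omega>"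
      using infdist_attained_frontier[OF nonempty, of z] z by metis
    obtain q where q: "ball q (\<kappa> * d z) \<subseteq> ball p (d z) \<inter> \<Omega>"
      using inner p(2) dz dr unfolding corkscrew_def by blast
    have "(2 * d z) powr (- (real DIM('a) + 2 * s)) * (unit_ball_vol (real DIM('a)) * (\<kappa> * d z) ^ DIM('a)) \<le> N z"
    proof (rule N_ge_ball[OF z])
      fix w assume "w \<in> ball q (\<kappa> * d z)"
      then have "dist p w < d z" using q by auto
      then show "norm (z - w) \<le> 2 * d z" using dist_triangle[of z w p] p(1) by (simp add: dist_norm)
    qed (use q \<kappa>_pos dz in auto)
    also have "(2 * d z) powr (- (real DIM('a) + 2 * s)) * (unit_ball_vol (real DIM('a)) * (\<kappa> * d z) ^ DIM('a)) = c1 * (d z powr (- (real DIM('a) + 2 * s)) * d z ^ DIM('a))"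
      using dz by (simp add: c1_def powr_mult power_mult_distrib)
    also have "d z powr (- (real DIM('a) + 2 * s)) * d z ^ DIM('a) = d z powr (- (2 * s))"
      using dz by (simp add: powr_realpow[symmetric] powr_add[symmetric])
    finally show ?thesis .
  qed
  have far: "c2 * d z powr (- (real DIM('a) + 2 * s)) \<le> N z" if z: "z \<notin> closure \<Omega>" and dr: "r < d z" for z
  proof -
    obtain p where p: "dist z p = d z" "p \<in> closure \<Omega>"
      using infdist_attained_frontier[OF nonempty, of z] by metis
    have "((1 + D / r) * d z) powr (- (real DIM('a) + 2 * s)) * (unit_ball_vol (real DIM('a)) * a0 ^ DIM('a)) \<le> N z"
    proof (rule N_ge_ball[OF z])
      fix w assume "w \<in> ball q0 a0"
      then have "w \<in> closure \<Omega>" using q0(2) closure_subset by blast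
      then have "dist z w \<le> d z + D" using D2[OF p(2)] dist_triangle[of z w p] p(1) by fastforce
      also have "\<dots> \<le> (1 + D / r) * d z"
      proof -
        have "D * r \<le> D * d z" using D dr by (intro mult_left_mono) auto
        then show ?thesis using r_pos by (simp add: field_simps)
      qed
      finally show "norm (z - w) \<le> (1 + D / r) * d z" by (simp add: dist_norm)
    qed (use q0 in auto)
    then show ?thesis using D r_pos infdist_nonneg by (simp add: c2_def powr_mult mult_ac)
  qed
  define C where "C = 1 / c1 + 1 / c2"
  have inv: "1 / N z \<le> C * d z powr b \<and> 0 < N z"
    if "z \<notin> closure \<Omega>" "c * d z powr (- b) \<le> N z" "0 < c" "1 / c \<le> C" for z b c
  proof -
    have dz: "0 < d z powr b" "0 < c * d z powr (- b)" using d_pos[OF that(1)] that(3) by auto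
    then have "0 < N z" using that(2) by linarith
    moreover have "1 / N z \<le> 1 / (c * d z powr (- b))" using that(2) dz by (intro divide_left_mono) auto
    moreover have "1 / (c * d z powr (- b)) = 1 / c * d z powr b" using dz by (simp add: powr_minus_divide)
    moreover have "\<dots> \<le> C * d z powr b" using that(4) dz by (intro mult_right_mono) auto
    ultimately show ?thesis by linarith
  qed
  show ?thesis
  proof (rule that[of C])
    show "0 < C" using c1 c2 by (simp add: C_def add_pos_pos)
    show "1 / N z \<le> C * d z powr (2 * s)" if "z \<notin> closure \<Omega>" "d z \<le> r" for z
      using inv[OF that(1) near[OF that] c1] c2 by (simp add: C_def)
    show "1 / N z \<le> C * d z powr (real DIM('a) + 2 * s)" if "z \<notin> closure \<Omega>" "r < d z" for z
      using inv[OF that(1) far[OF that] c2] c1 by (simp add: C_def)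
    show "0 < N z" if "z \<notin> closure \<Omega>" for z
      using inv[OF that near[OF that] c1] inv[OF that far[OF that] c2] c1 c2
      by (cases "d z \<le> r") (auto simp: C_def)
  qed
qed

lemma N_pos: "z \<notin> closure \<Omega> \<Longrightarrow> 0 < N z"
  using N_lower by blast

section \<open>The integrand of the Neumann kernel and the logarithmic upper bound\<close>

definition F :: "'a \<Rightarrow> 'a \<Rightarrow> 'a \<Rightarrow> real" where
  "F x y z = indicator (- closure \<Omega>) z * (K x z * K y z / N z)"

lemma F_nonneg [simp]: "0 \<le> F x y z" by (simp add: F_def)

lemma F_measurable [measurable (raw)]:
  assumes [measurable]: "f \<in> borel_measurable M" "g \<in> borel_measurable M" "h \<in> borel_measurable M"
  shows "(\<lambda>w. F (f w) (g w) (h w)) \<in> borel_measurable M"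
  unfolding F_def by measurable

lemma AE_not_frontier: "AE z in lebesgue. z \<notin> frontier \<Omega>"
  using frontier_null by (intro AE_not_in) (simp add: negligible_iff_null_sets)

text \<open>\<open>F\<close> cuts out the frontier as well, so that \<open>N z > 0\<close> wherever
  its indicator is 1. The frontier is null, and Borel measurability of \<open>F\<close> allows
  passing from \<open>lebesgue\<close> to \<open>lborel\<close>.\<close>

lemma neumann_kernel_F: "neumann_kernel s \<Omega> x y = (\<integral>z. F x y z \<partial>lborel)"
proof -
  have "neumann_kernel s \<Omega> x y = (LINT z : - \<Omega> | lebesgue. K x z * K y z / N z)"
    by (simp add: neumann_kernel_def N_def)
  also have "\<dots> = (\<integral>z. F x y z \<partial>lebesgue)"
    unfolding set_lebesgue_integral_def
  proof (rule integral_cong_AE)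
    show "(\<lambda>z. indicator (- \<Omega>) z *\<^sub>R (K x z * K y z / N z)) \<in> borel_measurable lebesgue"
      by (intro measurable_completion) measurable
    show "F x y \<in> borel_measurable lebesgue" by (intro measurable_completion) measurable
    show "AE z in lebesgue. indicator (- \<Omega>) z *\<^sub>R (K x z * K y z / N z) = F x y z"
      using AE_not_frontier
      by eventually_elim
        (use open_dom closure_subset in \<open>auto simp: F_def indicator_def frontier_def interior_open\<close>)
  qed
  also have "\<dots> = (\<integral>z. F x y z \<partial>lborel)" by (rule integral_completion) measurable
  finally show ?thesis .
qed

lemma dist_compl_le:
  assumes "z \<notin> closure \<Omega>"
  shows "infdist y (- \<Omega>) \<le> norm (y - z)"
  using infdist_le[of z "- \<Omega>" y] assms closure_subset by (auto simp: dist_norm)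

lemma dist_compl_pos:
  assumes "y \<in> \<Omega>"
  shows "0 < infdist y (- \<Omega>)"
proof -
  \<comment> \<open>\<open>infdist\<close> to the empty set is 0 by convention, so the complement
    must be known to be nonempty.\<close>
  have "- \<Omega> \<noteq> {}" using bounded_dom by (metis Compl_empty_eq double_complement not_bounded_UNIV)
  moreover have "closure (- \<Omega>) = - \<Omega>" using open_dom by (simp add: closure_closed closed_Compl)
  ultimately show ?thesis using assms
    by (metis ComplD in_closure_iff_infdist_zero infdist_nonneg less_le)
qed

text \<open>
  The first summand covers the points \<open>z\<close> far from \<open>y\<close> or from \<open>\<Omega>\<close>; the second one integrates to the
  logarithm.
\<close>

lemma F_upper:
  obtains C where "0 < C" and
    "\<And>x y z. x \<in> \<Omega> \<Longrightarrow> y \<in> \<Omega> \<Longrightarrow> F x y z \<le> C * (K x z * indicator {z. infdist x (- \<Omega>) \<le> norm (z - x)} z)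
       + C * infdist x (- \<Omega>) powr (- (real DIM('a) + 2 * s)) * (norm (z - y) powr (- real DIM('a)) * indicator {z. infdist y (- \<Omega>) \<le> norm (z - y) \<and> norm (z - y) \<le> 1} z)"
proof -
  obtain C where C: "0 < C"
    "\<And>z. z \<notin> closure \<Omega> \<Longrightarrow> 0 < N z"
    "\<And>z. z \<notin> closure \<Omega> \<Longrightarrow> d z \<le> r \<Longrightarrow> 1 / N z \<le> C * d z powr (2 * s)"
    "\<And>z. z \<notin> closure \<Omega> \<Longrightarrow> r < d z \<Longrightarrow> 1 / N z \<le> C * d z powr (real DIM('a) + 2 * s)"
    using N_lower by blast
  show ?thesis
  proof (rule that[OF C(1)])
    fix x y z assume x: "x \<in> \<Omega>" and y: "y \<in> \<Omega>"
    let ?A = "C * (K x z * indicator {z. infdist x (- \<Omega>) \<le> norm (z - x)} z)"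
    let ?B = "C * infdist x (- \<Omega>) powr (- (real DIM('a) + 2 * s)) * (norm (z - y) powr (- real DIM('a)) * indicator {z. infdist y (- \<Omega>) \<le> norm (z - y) \<and> norm (z - y) \<le> 1} z)"
    have A0: "0 \<le> ?A" and B0: "0 \<le> ?B" using C by auto
    show "F x y z \<le> ?A + ?B"
    proof (cases "z \<in> closure \<Omega>")
      case True
      then show ?thesis using A0 B0 by (simp add: F_def)
    next
      case z: False
      have F: "F x y z = K x z * (K y z * (1 / N z))" using z by (simp add: F_def)
      have xz: "infdist x (- \<Omega>) \<le> norm (z - x)" and yz: "infdist y (- \<Omega>) \<le> norm (z - y)"
        using dist_compl_le[OF z] by (simp_all add: norm_minus_commute)
      have A: "?A = K x z * C" using xz by simp
      have t: "0 < norm (z - y)" using dist_compl_pos[OF y] yz by linarith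
      have dt: "d z \<le> norm (z - y)" using d_le y closure_subset by blast
      have Ky: "K y z = norm (z - y) powr (- (real DIM('a) + 2 * s))" by (simp add: frac_kernel_powr norm_minus_commute)
      show ?thesis
      \<comment> \<open>The two regimes of \<open>N_lower\<close>, combined with
        \<open>d z \<le> norm (z - y)\<close>: near \<open>\<Omega>\<close> the powers of
        \<open>norm (z - y)\<close> leave minus the dimension as exponent, far away they cancel
        completely.\<close>
      proof (cases "d z \<le> r")
        case True
        have "1 / N z \<le> C * norm (z - y) powr (2 * s)"
          using C(3)[OF z True] C(1) dt s_pos
          by (meson infdist_nonneg less_imp_le mult_left_mono order_trans powr_mono2 mult_pos_pos zero_less_numeral)
        then have "K y z * (1 / N z) \<le> K y z * (C * norm (z - y) powr (2 * s))"
          by (rule mult_left_mono) simp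
        also have "\<dots> = C * norm (z - y) powr (- real DIM('a))"
          using t by (simp add: Ky powr_add[symmetric])
        finally have 1: "F x y z \<le> K x z * (C * norm (z - y) powr (- real DIM('a)))"
          unfolding F by (rule mult_left_mono) simp
        show ?thesis
        \<comment> \<open>Within distance 1 of \<open>y\<close> the factor \<open>K x z\<close> is
          bounded through the distance of \<open>x\<close> to the complement. Beyond it the power of
          \<open>norm (z - y)\<close> is at most 1 and the tail of \<open>K x\<close> carries the
          integral.\<close>
        proof (cases "norm (z - y) \<le> 1")
          case True
          have "K x z \<le> infdist x (- \<Omega>) powr (- (real DIM('a) + 2 * s))"
            using frac_kernel_le[of s "infdist x (- \<Omega>)" x z] s_pos dist_compl_pos[OF x] xz
            by (simp add: norm_minus_commute)
          then have "K x z * (C * norm (z - y) powr (- real DIM('a))) \<le> infdist x (- \<Omega>) powr (- (real DIM('a) + 2 * s)) * (C * norm (z - y) powr (- real DIM('a)))"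
            using C by (intro mult_right_mono) auto
          then have "F x y z \<le> ?B" using 1 True yz by (simp add: mult_ac)
          then show ?thesis using A0 by linarith
        next
          case False
          then have "norm (z - y) powr (- real DIM('a)) \<le> 1"
            using powr_mono2'[of "- real DIM('a)" 1 "norm (z - y)"] by simp
          then have "C * norm (z - y) powr (- real DIM('a)) \<le> C * 1"
            using C by (intro mult_left_mono) auto
          then have "K x z * (C * norm (z - y) powr (- real DIM('a))) \<le> K x z * C"
            by (intro mult_left_mono) auto
          then show ?thesis using 1 A B0 by linarith
        qed
      next
        case False
        then have "1 / N z \<le> C * norm (z - y) powr (real DIM('a) + 2 * s)"
          using C(4)[OF z] C(1) dt \<nu>_pos
          by (meson infdist_nonneg less_imp_le mult_left_mono order_trans powr_mono2 not_le)
        then have "K y z * (1 / N z) \<le> K y z * (C * norm (z - y) powr (real DIM('a) + 2 * s))"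
          by (rule mult_left_mono) simp
        also have "\<dots> = C" using t by (simp add: Ky powr_add[symmetric])
        finally have "F x y z \<le> K x z * C" unfolding F by (rule mult_left_mono) simp
        then show ?thesis using A B0 by linarith
      qed
    qed
  qed
qed

text \<open>Integrating the pointwise bound, the first summand becomes a tail of the kernel at
  \<open>x\<close> and the second an annulus integral about \<open>y\<close>, which is the
  logarithm. Working with nonnegative integrals yields integrability of \<open>F x y\<close> at the
  same time.\<close>

lemma F_nn_upper:
  assumes x: "x \<in> \<Omega>"
  obtains C where "0 < C" and
    "\<And>y. y \<in> \<Omega> \<Longrightarrow> (\<integral>\<^sup>+z. ennreal (F x y z) \<partial>lborel) \<le> ennreal (C * (1 + \<bar>ln (infdist y (- \<Omega>))\<bar>))"
proof -
  let ?\<delta> = "infdist x (- \<Omega>)"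
  obtain C where C: "0 < C" and
    CF: "\<And>y z. y \<in> \<Omega> \<Longrightarrow> F x y z \<le> C * (K x z * indicator {z. ?\<delta> \<le> norm (z - x)} z)
       + C * ?\<delta> powr (- (real DIM('a) + 2 * s)) * (norm (z - y) powr (- real DIM('a)) * indicator {z. infdist y (- \<Omega>) \<le> norm (z - y) \<and> norm (z - y) \<le> 1} z)"
    by (rule F_upper) (rule that, assumption, simp add: x)
  define C1 where "C1 = C * (real DIM('a) * unit_ball_vol (real DIM('a)) / (2 * s) * ?\<delta> powr (- (2 * s)))"
  define C2 where "C2 = C * ?\<delta> powr (- (real DIM('a) + 2 * s)) * (real DIM('a) * unit_ball_vol (real DIM('a)))"
  have \<delta>: "0 < ?\<delta>" using dist_compl_pos[OF x] .
  have C1: "0 < C1" and C2: "0 < C2"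
    using C \<delta> n_pos \<omega>_pos s_pos unfolding C1_def C2_def by (auto intro!: mult_pos_pos divide_pos_pos)
  show ?thesis
  proof (rule that[of "C1 + C2"])
    show "0 < C1 + C2" using C1 C2 by simp
    fix y assume y: "y \<in> \<Omega>"
    let ?\<eta> = "infdist y (- \<Omega>)"
    have \<eta>: "0 < ?\<eta>" using dist_compl_pos[OF y] .
    have "(\<integral>\<^sup>+z. ennreal (F x y z) \<partial>lborel)
      \<le> (\<integral>\<^sup>+z. ennreal C * (ennreal (K x z) * indicator {z. ?\<delta> \<le> norm (z - x)} z)
         + ennreal (C * ?\<delta> powr (- (real DIM('a) + 2 * s))) * (ennreal (norm (z - y) powr (- real DIM('a))) * indicator {z. ?\<eta> \<le> norm (z - y) \<and> norm (z - y) \<le> 1} z) \<partial>lborel)"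
    proof (rule nn_integral_mono)
      fix z
      have "ennreal (F x y z) \<le> ennreal (C * (K x z * indicator {z. ?\<delta> \<le> norm (z - x)} z)
       + C * ?\<delta> powr (- (real DIM('a) + 2 * s)) * (norm (z - y) powr (- real DIM('a)) * indicator {z. ?\<eta> \<le> norm (z - y) \<and> norm (z - y) \<le> 1} z))"
        using CF[OF y] by (rule ennreal_leI)
      then show "ennreal (F x y z) \<le> ennreal C * (ennreal (K x z) * indicator {z. ?\<delta> \<le> norm (z - x)} z)
         + ennreal (C * ?\<delta> powr (- (real DIM('a) + 2 * s))) * (ennreal (norm (z - y) powr (- real DIM('a))) * indicator {z. ?\<eta> \<le> norm (z - y) \<and> norm (z - y) \<le> 1} z)"
        using C by (simp add: ennreal_mult ennreal_indicator)
    qed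
    also have "\<dots> = ennreal C * (\<integral>\<^sup>+z. ennreal (K x z) * indicator {z. ?\<delta> \<le> norm (z - x)} z \<partial>lborel)
      + ennreal (C * ?\<delta> powr (- (real DIM('a) + 2 * s))) * (\<integral>\<^sup>+z. ennreal (norm (z - y) powr (- real DIM('a))) * indicator {z. ?\<eta> \<le> norm (z - y) \<and> norm (z - y) \<le> 1} z \<partial>lborel)"
      by (simp add: nn_integral_add nn_integral_cmult)
    also have "\<dots> \<le> ennreal C1 + ennreal (C2 * \<bar>ln ?\<eta>\<bar>)"
    proof (rule add_mono)
      show "ennreal C * (\<integral>\<^sup>+z. ennreal (K x z) * indicator {z. ?\<delta> \<le> norm (z - x)} z \<partial>lborel) \<le> ennreal C1"
        unfolding nn_integral_frac_kernel_outside[OF s_pos \<delta>] C1_def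
        using C s_pos \<omega>_pos by (simp add: ennreal_mult[symmetric])
      have "(\<integral>\<^sup>+z. ennreal (norm (z - y) powr (- real DIM('a))) * indicator {z. ?\<eta> \<le> norm (z - y) \<and> norm (z - y) \<le> 1} z \<partial>lborel) \<le> ennreal (real DIM('a) * unit_ball_vol (real DIM('a)) * \<bar>ln ?\<eta>\<bar>)"
      proof (cases "?\<eta> \<le> 1")
        case True
        then show ?thesis using nn_integral_powr_annulus[OF \<eta> True, of y] \<eta> by simp
      next
        case False
        then have "{z. ?\<eta> \<le> norm (z - y) \<and> norm (z - y) \<le> 1} = {}" by auto
        then show ?thesis by simp
      qed
      then have "ennreal (C * ?\<delta> powr (- (real DIM('a) + 2 * s))) * (\<integral>\<^sup>+z. ennreal (norm (z - y) powr (- real DIM('a))) * indicator {z. ?\<eta> \<le> norm (z - y) \<and> norm (z - y) \<le> 1} z \<partial>lborel)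
        \<le> ennreal (C * ?\<delta> powr (- (real DIM('a) + 2 * s))) * ennreal (real DIM('a) * unit_ball_vol (real DIM('a)) * \<bar>ln ?\<eta>\<bar>)"
        by (rule mult_left_mono) simp
      also have "\<dots> = ennreal (C2 * \<bar>ln ?\<eta>\<bar>)"
        using C \<omega>_pos by (simp add: ennreal_mult[symmetric] C2_def mult_ac)
      finally show "ennreal (C * ?\<delta> powr (- (real DIM('a) + 2 * s))) * (\<integral>\<^sup>+z. ennreal (norm (z - y) powr (- real DIM('a))) * indicator {z. ?\<eta> \<le> norm (z - y) \<and> norm (z - y) \<le> 1} z \<partial>lborel) \<le> ennreal (C2 * \<bar>ln ?\<eta>\<bar>)" .
    qed
    also have "\<dots> = ennreal (C1 + C2 * \<bar>ln ?\<eta>\<bar>)" using C1 C2 by (simp add: ennreal_plus[symmetric] del: ennreal_plus)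
    also have "\<dots> \<le> ennreal ((C1 + C2) * (1 + \<bar>ln ?\<eta>\<bar>))"
      using C1 C2 by (intro ennreal_leI) (simp add: algebra_simps)
    finally show "(\<integral>\<^sup>+z. ennreal (F x y z) \<partial>lborel) \<le> ennreal ((C1 + C2) * (1 + \<bar>ln ?\<eta>\<bar>))" .
  qed
qed

lemma F_integrable:
  assumes "x \<in> \<Omega>" "y \<in> \<Omega>"
  shows "integrable lborel (F x y)"
proof (rule integrableI_bounded)
  obtain C where "(\<integral>\<^sup>+z. ennreal (F x y z) \<partial>lborel) \<le> ennreal (C * (1 + \<bar>ln (infdist y (- \<Omega>))\<bar>))"
    using F_nn_upper[OF assms(1)] assms(2) by metis
  also have "\<dots> < \<infinity>" by simp
  finally show "(\<integral>\<^sup>+z. ennreal (norm (F x y z)) \<partial>lborel) < \<infinity>" by simp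
qed measurable

lemma nn_F:
  assumes "x \<in> \<Omega>" "y \<in> \<Omega>"
  shows "(\<integral>\<^sup>+z. ennreal (F x y z) \<partial>lborel) = ennreal (neumann_kernel s \<Omega> x y)"
  unfolding neumann_kernel_F using assms by (intro nn_integral_eq_integral F_integrable) auto

lemma neumann_kernel_upper:
  assumes x: "x \<in> \<Omega>"
  obtains C where "0 < C" and
    "\<And>y. y \<in> \<Omega> \<Longrightarrow> neumann_kernel s \<Omega> x y \<le> C * (1 + \<bar>ln (infdist y (- \<Omega>))\<bar>)"
proof -
  obtain C where C: "0 < C" and
    *: "\<And>y. y \<in> \<Omega> \<Longrightarrow> (\<integral>\<^sup>+z. ennreal (F x y z) \<partial>lborel) \<le> ennreal (C * (1 + \<bar>ln (infdist y (- \<Omega>))\<bar>))"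
    using F_nn_upper[OF x] by metis
  show ?thesis
  proof (rule that[OF C])
    fix y assume "y \<in> \<Omega>"
    from *[OF this] C show "neumann_kernel s \<Omega> x y \<le> C * (1 + \<bar>ln (infdist y (- \<Omega>))\<bar>)"
      unfolding nn_F[OF x \<open>y \<in> \<Omega>\<close>] by (subst (asm) ennreal_le_iff) auto
  qed
qed

section \<open>Lower bound, continuity and Fubini for the kernel\<close>

text \<open>Halving the radius turns a ball outside \<open>\<Omega>\<close> into one whose points
  have a definite distance from \<open>\<Omega>\<close>; an open ball missing
  \<open>\<Omega>\<close> also misses its closure.\<close>

lemma outside_half_ball:
  assumes "ball q a \<subseteq> - \<Omega>" "z \<in> ball q (a / 2)"
  shows "a / 2 \<le> d z" "z \<notin> closure \<Omega>"
proof -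
  have "dist q z < a / 2" using assms(2) by simp
  then have a: "0 < a" using zero_le_dist[of q z] by linarith
  obtain p where p: "p \<in> closure \<Omega>" "dist z p = d z"
    using infdist_attained_frontier[OF nonempty] by metis
  have "ball q a \<inter> closure \<Omega> = {}"
    using assms(1) open_Int_closure_eq_empty[of "ball q a" \<Omega>] by auto
  then have "a \<le> dist q p" using p(1) by force
  then show 1: "a / 2 \<le> d z" using assms(2) dist_triangle[of q p z] p(2) by simp
  show "z \<notin> closure \<Omega>"
    using 1 a in_closure_iff_infdist_zero[OF nonempty, of z] by auto
qed

text \<open>Counterpart of \<open>F_upper\<close>: the two kernels are at least their values at the
  distances \<open>X\<close> and \<open>b\<close>, and \<open>N_le\<close> bounds
  \<open>1 / N z\<close> from below by a multiple of \<open>d z powr (2 * s)\<close> at every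
  exterior point.\<close>

lemma F_lower:
  assumes "x \<in> \<Omega>" "y \<in> \<Omega>" and z: "z \<notin> closure \<Omega>" and "norm (x - z) \<le> X" "norm (y - z) \<le> b"
    and e: "0 < e" "e \<le> d z"
  shows "X powr (- (real DIM('a) + 2 * s)) * b powr (- (real DIM('a) + 2 * s))
           * (2 * s / (real DIM('a) * unit_ball_vol (real DIM('a))) * e powr (2 * s)) \<le> F x y z"
proof -
  have "x \<noteq> z" "y \<noteq> z" using assms closure_subset by auto
  then have K: "X powr (- (real DIM('a) + 2 * s)) \<le> K x z" "b powr (- (real DIM('a) + 2 * s)) \<le> K y z"
    using frac_kernel_ge[of s x z X] frac_kernel_ge[of s y z b] s_pos assms by auto
  let ?c = "real DIM('a) * unit_ball_vol (real DIM('a)) / (2 * s)"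
  have c: "0 < ?c" using s_pos \<omega>_pos by (intro divide_pos_pos mult_pos_pos) auto
  have "e powr (2 * s) \<le> d z powr (2 * s)" using e s_pos by (intro powr_mono2) auto
  moreover have ic: "0 \<le> 1 / ?c" using c by (rule less_imp_le[OF zero_less_divide_1_iff[THEN iffD2]])
  ultimately have "1 / ?c * e powr (2 * s) \<le> 1 / ?c * d z powr (2 * s)"
    by (rule mult_left_mono)
  also have "\<dots> = 1 / (?c * d z powr (- (2 * s)))"
    by (simp add: powr_minus_divide)
  also have "\<dots> \<le> 1 / N z"
    using N_le[OF z] N_pos[OF z] c d_pos[OF z] by (intro divide_left_mono mult_pos_pos) auto
  finally have N: "1 / ?c * e powr (2 * s) \<le> 1 / N z" .
  have "X powr (- (real DIM('a) + 2 * s)) * b powr (- (real DIM('a) + 2 * s)) * (1 / ?c * e powr (2 * s))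
     \<le> K x z * K y z * (1 / N z)"
    by (intro mult_mono K N mult_nonneg_nonneg ic) auto
  then show ?thesis using z by (simp add: F_def)
qed

lemma exterior_point:
  assumes "y \<in> \<Omega>"
  obtains p where "p \<in> frontier (- \<Omega>)" "dist y p = infdist y (- \<Omega>)"
proof -
  have "- \<Omega> \<noteq> {}" using bounded_dom by (metis Compl_empty_eq double_complement not_bounded_UNIV)
  moreover have "y \<notin> closure (- \<Omega>)" using assms open_dom by (simp add: closure_closed closed_Compl)
  ultimately show ?thesis using infdist_attained_frontier[of "- \<Omega>" y] that by metis
qed

lemma dist_frontier_bound:
  assumes "x \<in> \<Omega>" "p \<in> frontier (- \<Omega>)" "dist p z < \<rho>" "\<rho> \<le> r"
    and "\<And>a b. a \<in> closure \<Omega> \<Longrightarrow> b \<in> closure \<Omega> \<Longrightarrow> dist a b \<le> D"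
  shows "norm (x - z) \<le> D + r"
proof -
  have "p \<in> closure \<Omega>" "x \<in> closure \<Omega>"
    using assms closure_subset by (auto simp: frontier_def closure_complement interior_complement)
  then have "dist x p \<le> D" using assms by blast
  then show ?thesis using assms(3,4) dist_triangle[of x z p] by (simp add: dist_norm)
qed

text \<open>At scale \<open>\<rho>\<close> the integrand is at least of order \<open>\<rho>\<close>
  to minus the dimension on a ball whose volume is of the inverse order, so each scale contributes
  the same constant \<open>c\<close>. The ratio \<open>\<Lambda>\<close> keeps the balls of
  different scales disjoint, so the contributions add up. The constants depend on neither
  \<open>x\<close> nor \<open>y\<close>.\<close>

lemma neumann_kernel_ge_dyadic:
  obtains c \<Lambda> where "0 < c" "1 < \<Lambda>"
    "\<And>x y J. x \<in> \<Omega> \<Longrightarrow> y \<in> \<Omega> \<Longrightarrow> (\<And>j. j < J \<Longrightarrow> \<Lambda> ^ j * infdist y (- \<Omega>) \<le> r) \<Longrightarrow>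
       real J * c \<le> neumann_kernel s \<Omega> x y"
proof -
  obtain D where D: "1 \<le> D" "\<And>a b. a \<in> closure \<Omega> \<Longrightarrow> b \<in> closure \<Omega> \<Longrightarrow> dist a b \<le> D"
    by (rule diam_bound) blast
  \<comment> \<open>Points of the exterior ball at scale \<open>\<rho>\<close> lie between \<open>\<kappa> \<rho> / 2\<close> and \<open>2 \<rho>\<close> from \<open>y\<close>; this ratio
    separates the annuli of consecutive scales.\<close>
  define \<Lambda> where "\<Lambda> = 4 / \<kappa> + 1"
  have \<Lambda>: "1 < \<Lambda>" "2 \<le> \<kappa> * \<Lambda> / 2" using \<kappa>_pos by (auto simp: \<Lambda>_def field_simps)
  let ?n = "real DIM('a)"
  \<comment> \<open>The bound of \<open>F_lower\<close> with \<open>X = D + r\<close>,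
    \<open>b = 2 * \<rho>\<close> and \<open>e = \<kappa> * \<rho> / 2\<close>. The constant
    \<open>c\<close> is its product with the volume of the halved exterior ball, all powers of
    \<open>\<rho>\<close> having cancelled.\<close>
  define m where "m \<rho> = (D + r) powr (- (?n + 2 * s)) * (2 * \<rho>) powr (- (?n + 2 * s))
     * (2 * s / (?n * unit_ball_vol ?n) * (\<kappa> * \<rho> / 2) powr (2 * s))" for \<rho>
  define c where "c = (D + r) powr (- (?n + 2 * s)) * 2 powr (- (?n + 2 * s))
     * (2 * s / (?n * unit_ball_vol ?n) * (\<kappa> / 2) powr (2 * s)) * (unit_ball_vol ?n * (\<kappa> / 2) ^ DIM('a))"
  have c: "0 < c"
    unfolding c_def using D r_pos \<omega>_pos s_pos \<kappa>_pos
    by (intro mult_pos_pos divide_pos_pos zero_less_power) (auto simp: add_pos_pos)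
  have m: "m \<rho> * (unit_ball_vol ?n * (\<kappa> * \<rho> / 2) ^ DIM('a)) = c" if "0 < \<rho>" for \<rho>
  proof -
    have 1: "\<rho> powr (- (?n + 2 * s)) * (\<rho> powr (2 * s) * \<rho> ^ DIM('a)) = 1"
      using that by (simp add: powr_realpow[symmetric] powr_add[symmetric])
    have 2: "(2 * \<rho>) powr (- (?n + 2 * s)) = 2 powr (- (?n + 2 * s)) * \<rho> powr (- (?n + 2 * s))"
      using that by (simp add: powr_mult)
    have 3: "(\<kappa> * \<rho> / 2) powr (2 * s) = (\<kappa> / 2) powr (2 * s) * \<rho> powr (2 * s)"
      using that \<kappa>_pos powr_mult[of "\<kappa> / 2" \<rho> "2 * s"] by simp
    have 4: "(\<kappa> * \<rho> / 2) ^ DIM('a) = (\<kappa> / 2) ^ DIM('a) * \<rho> ^ DIM('a)"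
      using power_mult_distrib[of "\<kappa> / 2" \<rho> "DIM('a)"] by simp
    have "m \<rho> * (unit_ball_vol ?n * (\<kappa> * \<rho> / 2) ^ DIM('a))
      = c * (\<rho> powr (- (?n + 2 * s)) * (\<rho> powr (2 * s) * \<rho> ^ DIM('a)))"
      unfolding m_def c_def 2 3 4 by (simp only: mult_ac)
    then show ?thesis using 1 by simp
  qed
  show ?thesis
  proof (rule that[OF c \<Lambda>(1)])
    fix x y J assume x: "x \<in> \<Omega>" and y: "y \<in> \<Omega>"
      and J: "\<And>j. j < J \<Longrightarrow> \<Lambda> ^ j * infdist y (- \<Omega>) \<le> r"
    obtain p where p: "p \<in> frontier (- \<Omega>)" "dist y p = infdist y (- \<Omega>)"
      by (rule exterior_point[OF y])
    define \<rho> where "\<rho> j = \<Lambda> ^ j * infdist y (- \<Omega>)" for j :: nat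
    have \<rho>: "0 < \<rho> j" "infdist y (- \<Omega>) \<le> \<rho> j" for j
      using dist_compl_pos[OF y] \<Lambda>(1) by (auto simp: \<rho>_def intro: mult_right_mono[of 1, simplified])
    have \<rho>_step: "2 * \<rho> i \<le> \<kappa> * \<rho> j / 2" if "i < j" for i j
    proof -
      have "\<Lambda> ^ Suc i \<le> \<Lambda> ^ j" using that \<Lambda>(1) by (intro power_increasing) auto
      then have "\<rho> (Suc i) \<le> \<rho> j"
        unfolding \<rho>_def using dist_compl_pos[OF y] by (intro mult_right_mono) auto
      then have "\<kappa> * \<rho> (Suc i) / 2 \<le> \<kappa> * \<rho> j / 2" using \<kappa>_pos by simp
      moreover have "\<kappa> * \<rho> (Suc i) / 2 = (\<kappa> * \<Lambda> / 2) * \<rho> i" by (simp add: \<rho>_def)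
      moreover have "2 * \<rho> i \<le> (\<kappa> * \<Lambda> / 2) * \<rho> i" using \<Lambda>(2) \<rho>(1)[of i] by (intro mult_right_mono) auto
      ultimately show ?thesis by linarith
    qed
    have "\<exists>q. ball q (\<kappa> * \<rho> j) \<subseteq> ball p (\<rho> j) \<inter> - \<Omega>" if "j < J" for j
      using outer p(1) \<rho>(1)[of j] J[OF that] unfolding corkscrew_def \<rho>_def by blast
    then obtain q where q: "\<And>j. j < J \<Longrightarrow> ball (q j) (\<kappa> * \<rho> j) \<subseteq> ball p (\<rho> j) \<inter> - \<Omega>" by metis
    define S where "S j = ball (q j) (\<kappa> * \<rho> j / 2)" for j
    have S: "\<kappa> * \<rho> j / 2 \<le> d z" "z \<notin> closure \<Omega>" "dist p z < \<rho> j" if "z \<in> S j" "j < J" for z j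
    proof -
      have 1: "ball (q j) (\<kappa> * \<rho> j) \<subseteq> - \<Omega>" using q[OF that(2)] by blast
      show "\<kappa> * \<rho> j / 2 \<le> d z" "z \<notin> closure \<Omega>"
        using outside_half_ball[OF 1, of z] that(1) by (auto simp: S_def)
      have "0 < \<kappa> * \<rho> j" using \<kappa>_pos \<rho>(1) by simp
      then have "z \<in> ball (q j) (\<kappa> * \<rho> j)" using that(1) by (auto simp: S_def)
      then show "dist p z < \<rho> j" using q[OF that(2)] by auto
    qed
    have Sy: "norm (y - z) \<le> 2 * \<rho> j" if "z \<in> S j" "j < J" for z j
      using S(3)[OF that] dist_triangle[of y z p] p(2) \<rho>(2)[of j] by (simp add: dist_norm)
    \<comment> \<open>Strictness matters for disjointness, since the comparison of radii in
      \<open>\<rho>_step\<close> allows equality.\<close>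
    have Sy': "norm (y - z) < 2 * \<rho> j" if "z \<in> S j" "j < J" for z j
      using S(3)[OF that] dist_triangle[of y z p] p(2) \<rho>(2)[of j] by (simp add: dist_norm)
    have disj: "i = j" if "z \<in> S i" "z \<in> S j" "i < J" "j < J" for z i j
    proof -
      have no: False if "i < j" "z \<in> S i" "z \<in> S j" "i < J" "j < J" for i j
      proof -
        have "norm (y - z) < \<kappa> * \<rho> j / 2" using Sy'[OF that(2,4)] \<rho>_step[OF that(1)] by linarith
        also have "\<dots> \<le> d z" using S(1)[OF that(3,5)] .
        also have "\<dots> \<le> norm (z - y)" using d_le y closure_subset by blast
        finally show False by (simp add: norm_minus_commute)
      qed
      show ?thesis using no[of i j] no[of j i] that by (meson linorder_neqE_nat)
    qed
    have Fm: "m (\<rho> j) \<le> F x y z" if "z \<in> S j" "j < J" for z j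
      unfolding m_def
      using dist_frontier_bound[OF x p(1) S(3)[OF that] _ D(2)] J[OF that(2)] \<kappa>_pos \<rho>(1)[of j]
      by (intro F_lower x y S(1,2)[OF that] Sy[OF that]) (auto simp: \<rho>_def)
    \<comment> \<open>By disjointness at most one summand is nonzero at each
      \<open>z\<close>.\<close>
    have le: "(\<Sum>j<J. m (\<rho> j) * indicator (S j) z) \<le> F x y z" for z
    proof (cases "\<exists>j<J. z \<in> S j")
      case True
      then obtain j where j: "j < J" "z \<in> S j" by blast
      have "(\<Sum>i<J. m (\<rho> i) * indicator (S i) z) = (\<Sum>i<J. if i = j then m (\<rho> j) else 0)"
      proof (rule sum.cong)
        fix i assume "i \<in> {..<J}"
        then show "m (\<rho> i) * indicator (S i) z = (if i = j then m (\<rho> j) else 0)"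
          using disj[of z i j] j by (cases "i = j") (auto simp: indicator_def)
      qed simp
      also have "\<dots> = m (\<rho> j)" using j by simp
      finally show ?thesis using Fm[OF j(2,1)] by simp
    next
      case False
      then have "(\<Sum>i<J. m (\<rho> i) * indicator (S i) z) = 0" by (intro sum.neutral) auto
      then show ?thesis by simp
    qed
    have int: "integrable lborel (\<lambda>z. m (\<rho> j) * indicator (S j) z :: real)" for j
      unfolding S_def
      by (intro integrable_mult_right integrable_real_indicator emeasure_lborel_ball_finite) simp
    have "real J * c = (\<Sum>j<J. m (\<rho> j) * (unit_ball_vol ?n * (\<kappa> * \<rho> j / 2) ^ DIM('a)))"
      using m \<rho>(1) by simp
    also have "\<dots> = (\<Sum>j<J. \<integral>z. m (\<rho> j) * indicator (S j) z \<partial>lborel)"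
      using \<kappa>_pos \<rho>(1) by (intro sum.cong) (auto simp: S_def content_ball less_imp_le)
    also have "\<dots> = (\<integral>z. (\<Sum>j<J. m (\<rho> j) * indicator (S j) z) \<partial>lborel)"
      by (rule Bochner_Integration.integral_sum[symmetric]) (rule int)
    also have "\<dots> \<le> (\<integral>z. F x y z \<partial>lborel)"
      by (rule integral_mono[OF Bochner_Integration.integrable_sum[OF int] F_integrable[OF x y] le])
    finally show "real J * c \<le> neumann_kernel s \<Omega> x y" by (simp add: neumann_kernel_F)
  qed
qed

text \<open>One exterior ball at the fixed scale \<open>r\<close> serves all \<open>x\<close> and
  \<open>y\<close>. This covers points away from the boundary and absorbs the lower-order terms of
  the logarithmic bound.\<close>

lemma neumann_kernel_ge_const:
  obtains c where "0 < c" "\<And>x y. x \<in> \<Omega> \<Longrightarrow> y \<in> \<Omega> \<Longrightarrow> c \<le> neumann_kernel s \<Omega> x y"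
proof -
  obtain D where D: "1 \<le> D" "\<And>a b. a \<in> closure \<Omega> \<Longrightarrow> b \<in> closure \<Omega> \<Longrightarrow> dist a b \<le> D"
    by (rule diam_bound) blast
  obtain p where p: "p \<in> frontier (- \<Omega>)"
    using nonempty exterior_point by (metis ex_in_conv)
  obtain q where q: "ball q (\<kappa> * r) \<subseteq> ball p r \<inter> - \<Omega>"
    using outer p r_pos unfolding corkscrew_def by blast
  define S where "S = ball q (\<kappa> * r / 2)"
  let ?n = "real DIM('a)"
  define m where "m = (D + r) powr (- (?n + 2 * s)) * (D + r) powr (- (?n + 2 * s))
     * (2 * s / (?n * unit_ball_vol ?n) * (\<kappa> * r / 2) powr (2 * s))"
  have m: "0 < m" unfolding m_def using D r_pos \<omega>_pos s_pos \<kappa>_pos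
    by (intro mult_pos_pos divide_pos_pos) (auto simp: add_pos_pos)
  have \<kappa>r: "0 < \<kappa> * r" using \<kappa>_pos r_pos by simp
  show ?thesis
  proof (rule that[of "m * (unit_ball_vol ?n * (\<kappa> * r / 2) ^ DIM('a))"])
    show "0 < m * (unit_ball_vol ?n * (\<kappa> * r / 2) ^ DIM('a))" using m \<omega>_pos \<kappa>r by simp
    fix x y assume x: "x \<in> \<Omega>" and y: "y \<in> \<Omega>"
    have "m * (unit_ball_vol ?n * (\<kappa> * r / 2) ^ DIM('a)) = (\<integral>z. m * indicator S z \<partial>lborel)"
      using \<kappa>r by (simp add: S_def content_ball)
    also have "\<dots> \<le> (\<integral>z. F x y z \<partial>lborel)"
    proof (intro integral_mono F_integrable x y)
      show "integrable lborel (\<lambda>z. m * indicator S z :: real)" unfolding S_def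
        by (intro integrable_mult_right integrable_real_indicator emeasure_lborel_ball_finite) simp
      fix z show "m * indicator S z \<le> F x y z"
      proof (cases "z \<in> S")
        case True
        have 1: "ball q (\<kappa> * r) \<subseteq> - \<Omega>" using q by blast
        have 2: "z \<in> ball q (\<kappa> * r)" using True \<kappa>r by (auto simp: S_def)
        have pz: "dist p z < r" using q 2 by auto
        have "m \<le> F x y z" unfolding m_def
          using dist_frontier_bound[OF x p pz _ D(2)] dist_frontier_bound[OF y p pz _ D(2)] \<kappa>r
          using outside_half_ball[OF 1, of z] True
          by (intro F_lower x y) (auto simp: S_def)
        then show ?thesis using True by simp
      qed simp
    qed
    finally show "m * (unit_ball_vol ?n * (\<kappa> * r / 2) ^ DIM('a)) \<le> neumann_kernel s \<Omega> x y"
      by (simp add: neumann_kernel_F)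
  qed
qed

text \<open>Let \<open>\<delta>\<close> be the distance of \<open>y\<close> to the complement. The
  scales between \<open>\<delta>\<close> and \<open>r\<close> number about the logarithm of
  \<open>r / \<delta>\<close> to the base \<open>\<Lambda>\<close>, which gives
  \<open>a * (- ln \<delta>) - b\<close>. The constant bound absorbs the loss for
  \<open>\<delta> < 1\<close> and suffices for \<open>\<delta> \<ge> 1\<close>, where the logarithm
  is at most \<open>ln D\<close>. The resulting constant is uniform in \<open>x\<close> as
  well.\<close>

lemma neumann_kernel_lower:
  obtains e where "0 < e" "\<And>x y. x \<in> \<Omega> \<Longrightarrow> y \<in> \<Omega> \<Longrightarrow>
    e * (1 + \<bar>ln (infdist y (- \<Omega>))\<bar>) \<le> neumann_kernel s \<Omega> x y"
proof -
  obtain c0 where c0: "0 < c0" "\<And>x y. x \<in> \<Omega> \<Longrightarrow> y \<in> \<Omega> \<Longrightarrow> c0 \<le> neumann_kernel s \<Omega> x y"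
    by (rule neumann_kernel_ge_const) blast
  obtain c \<Lambda> where c: "0 < c" and \<Lambda>: "1 < \<Lambda>" and
    dy: "\<And>x y J. x \<in> \<Omega> \<Longrightarrow> y \<in> \<Omega> \<Longrightarrow> (\<And>j. j < J \<Longrightarrow> \<Lambda> ^ j * infdist y (- \<Omega>) \<le> r) \<Longrightarrow>
       real J * c \<le> neumann_kernel s \<Omega> x y"
    by (rule neumann_kernel_ge_dyadic) blast
  obtain D where D: "1 \<le> D" "\<And>a b. a \<in> closure \<Omega> \<Longrightarrow> b \<in> closure \<Omega> \<Longrightarrow> dist a b \<le> D"
    by (rule diam_bound) blast
  \<comment> \<open>Dividing by \<open>ln \<Lambda>\<close> converts a number of scales into a
    natural logarithm; \<open>b\<close> absorbs the term with \<open>ln r\<close>.\<close>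
  define a where "a = c / ln \<Lambda>"
  define b where "b = \<bar>a * ln r\<bar>"
  have a: "0 < a" using c \<Lambda> by (simp add: a_def)
  have b: "0 \<le> b" by (simp add: b_def)
  have log: "a * (- ln (infdist y (- \<Omega>))) - b \<le> neumann_kernel s \<Omega> x y" if x: "x \<in> \<Omega>" and y: "y \<in> \<Omega>" for x y
  proof -
    let ?\<delta> = "infdist y (- \<Omega>)"
    have \<delta>: "0 < ?\<delta>" using dist_compl_pos[OF y] .
    have "a * (ln r - ln ?\<delta>) \<le> neumann_kernel s \<Omega> x y"
    proof (cases "?\<delta> \<le> r")
      case False
      then have "ln r - ln ?\<delta> \<le> 0" using r_pos by simp
      then have "a * (ln r - ln ?\<delta>) \<le> 0" using a by (simp add: mult_nonneg_nonpos)
      then show ?thesis using c0(2)[OF x y] c0(1) by linarith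
    next
      case True
      define l where "l = log \<Lambda> (r / ?\<delta>)"
      have l0: "0 \<le> l" using True \<delta> \<Lambda> r_pos by (simp add: l_def zero_le_log_cancel_iff)
      \<comment> \<open>The admissible exponents run from 0 to the floor of \<open>l\<close>, hence
        the added 1; it also gives \<open>l \<le> real J\<close>.\<close>
      define J where "J = nat \<lfloor>l\<rfloor> + 1"
      have Jl: "l \<le> real J" using l0 by (simp add: J_def) linarith
      have "real J * c \<le> neumann_kernel s \<Omega> x y"
      proof (rule dy[OF x y])
        fix j assume "j < J"
        then have "real j \<le> l" using l0 by (simp add: J_def) linarith
        then have "\<Lambda> powr (real j) \<le> \<Lambda> powr l" using \<Lambda> by simp
        also have "\<dots> = r / ?\<delta>" using \<Lambda> r_pos \<delta> by (simp add: l_def)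
        finally show "\<Lambda> ^ j * ?\<delta> \<le> r" using \<Lambda> \<delta> by (simp add: powr_realpow field_simps)
      qed
      moreover have "a * (ln r - ln ?\<delta>) = l * c"
        using r_pos \<delta> by (simp add: a_def l_def log_def ln_div)
      moreover have "l * c \<le> real J * c" using Jl c by (intro mult_right_mono) auto
      ultimately show ?thesis by linarith
    qed
    then show ?thesis by (simp add: b_def algebra_simps)
  qed
  \<comment> \<open>With \<open>k\<close> the kernel and \<open>\<delta>\<close> the distance,
    adding \<open>(a + b) / c0 * k \<ge> a + b\<close> to
    \<open>k \<ge> a * (- ln \<delta>) - b\<close> yields
    \<open>a * (1 - ln \<delta>) \<le> (1 + (a + b) / c0) * k\<close>, which dictates
    \<open>e1\<close>. The choice of \<open>e2\<close> makes
    \<open>e2 * (1 + ln D) = c0\<close>.\<close>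
  define e1 where "e1 = a / (1 + (a + b) / c0)"
  define e2 where "e2 = c0 / (1 + ln D)"
  have q: "0 < 1 + (a + b) / c0" using a b c0 by (simp add: add_pos_nonneg)
  have e1: "0 < e1" using a q by (simp add: e1_def)
  have lD: "0 \<le> ln D" using D by simp
  then have e2: "0 < e2" using c0 by (simp add: e2_def)
  show ?thesis
  proof (rule that[of "min e1 e2"])
    show "0 < min e1 e2" using e1 e2 by simp
    fix x y assume x: "x \<in> \<Omega>" and y: "y \<in> \<Omega>"
    let ?\<delta> = "infdist y (- \<Omega>)" and ?k = "neumann_kernel s \<Omega> x y"
    have \<delta>: "0 < ?\<delta>" using dist_compl_pos[OF y] .
    obtain p where p: "p \<in> frontier (- \<Omega>)" "dist y p = ?\<delta>" by (rule exterior_point[OF y])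
    then have "p \<in> closure \<Omega>" by (auto simp: frontier_def closure_complement interior_complement)
    then have \<delta>D: "?\<delta> \<le> D" using D(2)[of y p] p y closure_subset by auto
    show "min e1 e2 * (1 + \<bar>ln ?\<delta>\<bar>) \<le> ?k"
    proof (cases "?\<delta> < 1")
      case True
      then have ab: "\<bar>ln ?\<delta>\<bar> = - ln ?\<delta>" using \<delta> by simp
      have "a + b \<le> (a + b) / c0 * ?k"
      proof -
        have "(a + b) / c0 * c0 \<le> (a + b) / c0 * ?k" using c0 x y a b by (intro mult_left_mono) auto
        then show ?thesis using c0(1) by simp
      qed
      then have "a * (1 + \<bar>ln ?\<delta>\<bar>) \<le> (1 + (a + b) / c0) * ?k"
        using log[OF x y] unfolding ab by (simp add: algebra_simps)
      then have "e1 * (1 + \<bar>ln ?\<delta>\<bar>) \<le> ?k" using q by (simp add: e1_def field_simps)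
      moreover have "min e1 e2 * (1 + \<bar>ln ?\<delta>\<bar>) \<le> e1 * (1 + \<bar>ln ?\<delta>\<bar>)" by (intro mult_right_mono) auto
      ultimately show ?thesis by linarith
    next
      case False
      then have "\<bar>ln ?\<delta>\<bar> \<le> ln D" using \<delta>D by simp
      then have "e2 * (1 + \<bar>ln ?\<delta>\<bar>) \<le> e2 * (1 + ln D)" using e2 by (intro mult_left_mono) auto
      also have "\<dots> = c0" using lD by (simp add: e2_def)
      finally have "e2 * (1 + \<bar>ln ?\<delta>\<bar>) \<le> ?k" using c0(2)[OF x y] by linarith
      moreover have "min e1 e2 * (1 + \<bar>ln ?\<delta>\<bar>) \<le> e2 * (1 + \<bar>ln ?\<delta>\<bar>)" by (intro mult_right_mono) auto
      ultimately show ?thesis by linarith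
    qed
  qed
qed

section \<open>Continuity of the Neumann kernel\<close>

text \<open>Moving \<open>x\<close> by at most half its distance to the complement at most halves
  its distance to an exterior point, so the kernel grows by at most a fixed factor.\<close>

lemma frac_kernel_near:
  assumes "x \<in> \<Omega>" "norm (x' - x) \<le> infdist x (- \<Omega>) / 2" "z \<notin> closure \<Omega>"
  shows "K x' z \<le> 2 powr (real DIM('a) + 2 * s) * K x z"
proof -
  have t: "infdist x (- \<Omega>) \<le> norm (x - z)" "0 < infdist x (- \<Omega>)"
    using dist_compl_le dist_compl_pos assms by auto
  have "norm (x - z) / 2 \<le> norm (x' - z)"
    using norm_triangle_ineq[of "x - x'" "x' - z"] assms(2) t by (simp add: norm_minus_commute)
  then have "K x' z \<le> (norm (x - z) / 2) powr (- (real DIM('a) + 2 * s))"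
    using t s_pos by (intro frac_kernel_le) auto
  also have "\<dots> = 2 powr (real DIM('a) + 2 * s) * K x z"
  proof -
    have "(norm (x - z) / 2) powr (- b) = 2 powr b * norm (x - z) powr (- b)" for b :: real
      by (simp add: powr_divide powr_minus field_simps)
    then show ?thesis by (simp only: frac_kernel_powr)
  qed
  finally show ?thesis .
qed

text \<open>Dominated convergence, with a constant multiple of the limit integrand itself as
  majorant, by \<open>frac_kernel_near\<close> in both variables. Shifting the sequence by
  \<open>M\<close> makes the bound hold for every index.\<close>

lemma neumann_kernel_continuous:
  "continuous_on (\<Omega> \<times> \<Omega>) (\<lambda>(x, y). neumann_kernel s \<Omega> x y)"
  unfolding continuous_on_sequentially
proof (intro allI ballI impI, elim conjE)
  fix W :: "nat \<Rightarrow> 'a \<times> 'a" and w :: "'a \<times> 'a"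
  assume w: "w \<in> \<Omega> \<times> \<Omega>" and W: "\<forall>n. W n \<in> \<Omega> \<times> \<Omega>" and lim: "W \<longlonglongrightarrow> w"
  obtain x y where xy: "w = (x, y)" "x \<in> \<Omega>" "y \<in> \<Omega>" using w by auto
  have X: "(\<lambda>n. fst (W n)) \<longlonglongrightarrow> x" and Y: "(\<lambda>n. snd (W n)) \<longlonglongrightarrow> y"
    using tendsto_fst[OF lim] tendsto_snd[OF lim] xy by auto
  have "\<forall>\<^sub>F n in sequentially. dist (fst (W n)) x < infdist x (- \<Omega>) / 2 \<and> dist (snd (W n)) y < infdist y (- \<Omega>) / 2"
    using X Y dist_compl_pos xy by (intro eventually_conj tendstoD) auto
  then obtain M where M: "\<And>n. n \<ge> M \<Longrightarrow> dist (fst (W n)) x < infdist x (- \<Omega>) / 2 \<and> dist (snd (W n)) y < infdist y (- \<Omega>) / 2"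
    unfolding eventually_sequentially by blast
  let ?c = "2 powr (real DIM('a) + 2 * s)"
  have "(\<lambda>n. \<integral>z. F (fst (W (n + M))) (snd (W (n + M))) z \<partial>lborel) \<longlonglongrightarrow> (\<integral>z. F x y z \<partial>lborel)"
  proof (rule integral_dominated_convergence)
    show "integrable lborel (\<lambda>z. ?c * ?c * F x y z)"
      using F_integrable[OF xy(2,3)] by simp
    show "AE z in lborel. (\<lambda>n. F (fst (W (n + M))) (snd (W (n + M))) z) \<longlonglongrightarrow> F x y z"
    proof (intro AE_I2)
      fix z
      show "(\<lambda>n. F (fst (W (n + M))) (snd (W (n + M))) z) \<longlonglongrightarrow> F x y z"
      proof (cases "z \<in> closure \<Omega>")
        case True then show ?thesis by (simp add: F_def)
      next
        case False
        then have "x \<noteq> z" "y \<noteq> z" "N z \<noteq> 0" using xy closure_subset N_pos[OF False] by auto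
        then show ?thesis unfolding F_def frac_kernel_def
          using LIMSEQ_ignore_initial_segment[OF X, of M] LIMSEQ_ignore_initial_segment[OF Y, of M]
          by (intro tendsto_intros) auto
      qed
    qed
    fix n
    show "AE z in lborel. norm (F (fst (W (n + M))) (snd (W (n + M))) z) \<le> ?c * ?c * F x y z"
    proof (intro AE_I2)
      fix z
      show "norm (F (fst (W (n + M))) (snd (W (n + M))) z) \<le> ?c * ?c * F x y z"
      proof (cases "z \<in> closure \<Omega>")
        case True then show ?thesis by (simp add: F_def)
      next
        case False
        have "K (fst (W (n + M))) z \<le> ?c * K x z" "K (snd (W (n + M))) z \<le> ?c * K y z"
          using M[of "n + M"] xy False by (auto intro!: frac_kernel_near simp: dist_norm)
        then have "K (fst (W (n + M))) z * K (snd (W (n + M))) z / N z \<le> (?c * K x z) * (?c * K y z) / N z"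
          by (intro divide_right_mono mult_mono) auto
        then show ?thesis using False by (simp add: F_def mult_ac)
      qed
    qed
  qed measurable
  then have "(\<lambda>n. (\<lambda>(x, y). neumann_kernel s \<Omega> x y) (W (n + M))) \<longlonglongrightarrow> (\<lambda>(x, y). neumann_kernel s \<Omega> x y) w"
    by (simp add: neumann_kernel_F case_prod_beta xy)
  then show "((\<lambda>(x, y). neumann_kernel s \<Omega> x y) \<circ> W) \<longlonglongrightarrow> (\<lambda>(x, y). neumann_kernel s \<Omega> x y) w"
    unfolding o_def by (rule LIMSEQ_offset)
qed

section \<open>Interchanging the integrals over the domain and its exterior\<close>

lemma kernel_outside_integrable:
  assumes "x \<in> \<Omega>"
  shows "integrable lborel (\<lambda>z. indicator (- closure \<Omega>) z * K x z)"
proof (rule integrableI_bounded)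
  have "(\<integral>\<^sup>+z. ennreal (norm (indicator (- closure \<Omega>) z * K x z)) \<partial>lborel)
     \<le> (\<integral>\<^sup>+z. ennreal (K x z) * indicator {z. infdist x (- \<Omega>) \<le> norm (z - x)} z \<partial>lborel)"
    using dist_compl_le by (intro nn_integral_mono) (auto simp: indicator_def norm_minus_commute)
  also have "\<dots> < \<infinity>"
    by (simp add: nn_integral_frac_kernel_outside[OF s_pos dist_compl_pos[OF assms]])
  finally show "(\<integral>\<^sup>+z. ennreal (norm (indicator (- closure \<Omega>) z * K x z)) \<partial>lborel) < \<infinity>" .
qed measurable

lemma neumann_kernel_measurable: "x \<in> \<Omega> \<Longrightarrow> (\<lambda>y. neumann_kernel s \<Omega> x y) \<in> borel_measurable borel"
  unfolding neumann_kernel_F by (intro lborel.borel_measurable_lebesgue_integral) measurable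

text \<open>Absolute integrability holds because integrating \<open>K z y\<close> over
  \<open>y\<close> in \<open>\<Omega>\<close> gives \<open>N z\<close>, which cancels the
  denominator and leaves the integrable exterior tail of \<open>K x\<close>. The constant
  \<open>A\<close> will be \<open>u x\<close>; it is kept apart from \<open>v x\<close> because
  \<open>v\<close> agrees with \<open>u\<close> only almost everywhere.\<close>

lemma fubini_neumann:
  fixes v :: "'a \<Rightarrow> real"
  assumes x: "x \<in> \<Omega>" and [measurable]: "v \<in> borel_measurable borel" and v: "\<And>y. \<bar>v y\<bar> \<le> M"
  shows "integrable lborel (\<lambda>y. indicator \<Omega> y * ((A - v y) * neumann_kernel s \<Omega> x y))"
    and "integrable lborel (\<lambda>z. indicator (- closure \<Omega>) z * (K x z / N z * (\<integral>y. indicator \<Omega> y * ((A - v y) * K z y) \<partial>lborel)))"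
    and "(\<integral>y. indicator \<Omega> y * ((A - v y) * neumann_kernel s \<Omega> x y) \<partial>lborel) =
      (\<integral>z. indicator (- closure \<Omega>) z * (K x z / N z * (\<integral>y. indicator \<Omega> y * ((A - v y) * K z y) \<partial>lborel)) \<partial>lborel)"
proof -
  define H where "H z y = indicator \<Omega> y * (A - v y) * F x y z" for z y
  have [measurable]: "(\<lambda>(z, y). H z y) \<in> borel_measurable (lborel \<Otimes>\<^sub>M lborel)"
    unfolding H_def by measurable
  have H1: "H z y = indicator (- closure \<Omega>) z * (K x z / N z) * (indicator \<Omega> y * ((A - v y) * K z y))" for z y
    by (simp add: H_def F_def frac_kernel_commute[of s y z])
  have vA: "\<bar>A - v y\<bar> \<le> \<bar>A\<bar> + M" for y using v[of y] by linarith
  have M: "0 \<le> \<bar>A\<bar> + M" using vA[of x] by linarith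
  have inner: "integrable lborel (\<lambda>y. indicator \<Omega> y * ((A - v y) * K z y))" if "z \<notin> closure \<Omega>" for z
  proof (rule Bochner_Integration.integrable_bound)
    show "integrable lborel (\<lambda>y. (\<bar>A\<bar> + M) * (indicator \<Omega> y * K z y))"
      using kernel_integrable[OF that] by simp
    show "AE y in lborel. norm (indicator \<Omega> y * ((A - v y) * K z y)) \<le> norm ((\<bar>A\<bar> + M) * (indicator \<Omega> y * K z y))"
      using vA M by (intro AE_I2) (auto simp: abs_mult indicator_def intro!: mult_right_mono)
  qed measurable
  have Hz: "integrable lborel (\<lambda>y. H z y)" for z
    using inner[of z] unfolding H1 by (cases "z \<in> closure \<Omega>") auto
  have intH: "integrable (lborel \<Otimes>\<^sub>M lborel) (\<lambda>(z, y). H z y)"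
  proof (rule lborel_pair.Fubini_integrable)
    show "integrable lborel (\<lambda>z. \<integral>y. norm (case (z, y) of (z, y) \<Rightarrow> H z y) \<partial>lborel)"
    proof (rule Bochner_Integration.integrable_bound)
      show "integrable lborel (\<lambda>z. (\<bar>A\<bar> + M) * (indicator (- closure \<Omega>) z * K x z))"
        using kernel_outside_integrable[OF x] by simp
      show "(\<lambda>z. \<integral>y. norm (case (z, y) of (z, y) \<Rightarrow> H z y) \<partial>lborel) \<in> borel_measurable lborel"
        by (intro lborel.borel_measurable_lebesgue_integral) measurable
      show "AE z in lborel. norm (\<integral>y. norm (case (z, y) of (z, y) \<Rightarrow> H z y) \<partial>lborel)
          \<le> norm ((\<bar>A\<bar> + M) * (indicator (- closure \<Omega>) z * K x z))"
      proof (intro AE_I2)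
        fix z
        show "norm (\<integral>y. norm (case (z, y) of (z, y) \<Rightarrow> H z y) \<partial>lborel)
          \<le> norm ((\<bar>A\<bar> + M) * (indicator (- closure \<Omega>) z * K x z))"
        proof (cases "z \<in> closure \<Omega>")
          case True then show ?thesis by (simp add: H1)
        next
          case z: False
          have "(\<integral>y. norm (H z y) \<partial>lborel) \<le> (\<integral>y. (\<bar>A\<bar> + M) * (K x z / N z) * (indicator \<Omega> y * K z y) \<partial>lborel)"
          proof (rule integral_mono)
            show "integrable lborel (\<lambda>y. norm (H z y))" using Hz by simp
            show "integrable lborel (\<lambda>y. (\<bar>A\<bar> + M) * (K x z / N z) * (indicator \<Omega> y * K z y))"
              using kernel_integrable[OF z] by simp
            fix y
            have "K x z / N z * (\<bar>A - v y\<bar> * K z y) \<le> K x z / N z * ((\<bar>A\<bar> + M) * K z y)"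
              using vA by (intro mult_left_mono mult_right_mono) auto
            then show "norm (H z y) \<le> (\<bar>A\<bar> + M) * (K x z / N z) * (indicator \<Omega> y * K z y)"
              using z by (auto simp: H1 abs_mult indicator_def mult_ac)
          qed
          also have "\<dots> = (\<bar>A\<bar> + M) * (K x z / N z) * N z" by (simp add: N_lborel)
          also have "\<dots> = (\<bar>A\<bar> + M) * K x z" using N_pos[OF z] by simp
          finally show ?thesis using z M by (simp add: abs_mult)
        qed
      qed
    qed
    show "AE z in lborel. integrable lborel (\<lambda>y. case (z, y) of (z, y) \<Rightarrow> H z y)" using Hz by simp
  qed measurable
  have Iy: "(\<integral>z. H z y \<partial>lborel) = indicator \<Omega> y * ((A - v y) * neumann_kernel s \<Omega> x y)" for y
    by (simp add: H_def neumann_kernel_F)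
  have Iz: "(\<integral>y. H z y \<partial>lborel) = indicator (- closure \<Omega>) z * (K x z / N z * (\<integral>y. indicator \<Omega> y * ((A - v y) * K z y) \<partial>lborel))" for z
    unfolding H1 by simp
  show "integrable lborel (\<lambda>y. indicator \<Omega> y * ((A - v y) * neumann_kernel s \<Omega> x y))"
    using lborel_pair.integrable_snd[OF intH] unfolding Iy .
  show "integrable lborel (\<lambda>z. indicator (- closure \<Omega>) z * (K x z / N z * (\<integral>y. indicator \<Omega> y * ((A - v y) * K z y) \<partial>lborel)))"
    using lborel_pair.integrable_fst[OF intH] unfolding Iz .
  show "(\<integral>y. indicator \<Omega> y * ((A - v y) * neumann_kernel s \<Omega> x y) \<partial>lborel) =
      (\<integral>z. indicator (- closure \<Omega>) z * (K x z / N z * (\<integral>y. indicator \<Omega> y * ((A - v y) * K z y) \<partial>lborel)) \<partial>lborel)"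
    using lborel_pair.Fubini_integral[OF intH] unfolding Iy Iz .
qed

end

section \<open>Taylor expansion and principal values\<close>

lemma differentiable_imp_continuous_on_gradient:
  assumes "\<And>x. x \<in> S \<Longrightarrow> (f has_derivative (\<lambda>h. G x \<bullet> h)) (at x)"
  shows "continuous_on S f"
  using assms by (meson continuous_at_imp_continuous_on has_derivative_continuous)

lemma holder_class_loc_continuous:
  fixes f :: "'a::euclidean_space \<Rightarrow> real"
  assumes "open \<Omega>" "0 < \<gamma>" "holder_class_loc m \<gamma> \<Omega> f"
  shows "continuous_on \<Omega> f"
proof (cases m)
  case (Suc m')
  with assms(3) obtain G where "\<And>x. x \<in> \<Omega> \<Longrightarrow> (f has_derivative (\<lambda>h. G x \<bullet> h)) (at x)" by auto
  then show ?thesis by (rule differentiable_imp_continuous_on_gradient)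
next
  case 0
  have "isCont f x" if x: "x \<in> \<Omega>" for x
  proof -
    obtain e where e: "0 < e" "cball x e \<subseteq> \<Omega>" using assms(1) x open_contains_cball by metis
    have "\<exists>C. \<forall>a\<in>cball x e. \<forall>b\<in>cball x e. \<bar>f a - f b\<bar> \<le> C * norm (a - b) powr \<gamma>"
      using assms(3) e(2) 0 by simp
    then obtain C where C: "\<And>a b. a \<in> cball x e \<Longrightarrow> b \<in> cball x e \<Longrightarrow> \<bar>f a - f b\<bar> \<le> C * norm (a - b) powr \<gamma>"
      by blast
    have lim: "((\<lambda>y. C * norm (y - x) powr \<gamma>) \<longlongrightarrow> C * 0) (at x)"
    proof (intro tendsto_mult_left)
      have "((\<lambda>y. norm (y - x)) \<longlongrightarrow> norm (x - x)) (at x)" by (intro tendsto_intros)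
      then have "((\<lambda>y. norm (y - x)) \<longlongrightarrow> 0) (at x)" by simp
      then show "((\<lambda>y. norm (y - x) powr \<gamma>) \<longlongrightarrow> 0) (at x)"
        using assms(2) by (intro tendsto_zero_powrI[where b = \<gamma>]) auto
    qed
    have "\<forall>\<^sub>F y in at x. norm (f y - f x) \<le> C * norm (y - x) powr \<gamma>"
      unfolding eventually_at using C e(1) by (intro exI[of _ e]) (auto simp: dist_commute)
    then have "((\<lambda>y. f y - f x) \<longlongrightarrow> 0) (at x)"
      by (rule Lim_null_comparison) (use lim in simp)
    then show ?thesis by (simp add: isCont_def LIM_zero_iff)
  qed
  then show ?thesis by (simp add: continuous_at_imp_continuous_on)
qed

text \<open>For \<open>m > 0\<close> the gradient components lie in the class of the preceding
  order, hence are continuous and bounded on a closed ball, which gives a Lipschitz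
  estimate.\<close>

lemma holder_class_loc_modulus:
  fixes f :: "'a::euclidean_space \<Rightarrow> real"
  assumes "open \<Omega>" "0 < \<gamma>" "holder_class_loc m \<gamma> \<Omega> f" "x \<in> \<Omega>"
  obtains e C where "0 < e" "0 \<le> C" "cball x e \<subseteq> \<Omega>"
    "\<And>y. y \<in> cball x e \<Longrightarrow> \<bar>f y - f x\<bar> \<le> C * norm (y - x) powr (if m = 0 then \<gamma> else 1)"
proof -
  obtain e where e: "0 < e" "cball x e \<subseteq> \<Omega>" using assms(1,4) open_contains_cball by metis
  show ?thesis
  proof (cases m)
    case 0
    have "\<exists>C. \<forall>a\<in>cball x e. \<forall>b\<in>cball x e. \<bar>f a - f b\<bar> \<le> C * norm (a - b) powr \<gamma>"
      using assms(3) e(2) 0 by simp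
    then obtain C where C: "\<And>a b. a \<in> cball x e \<Longrightarrow> b \<in> cball x e \<Longrightarrow> \<bar>f a - f b\<bar> \<le> C * norm (a - b) powr \<gamma>"
      by blast
    show ?thesis
    proof (rule that[of e "\<bar>C\<bar>"])
      fix y assume "y \<in> cball x e"
      then have "\<bar>f y - f x\<bar> \<le> C * norm (y - x) powr \<gamma>" using C e by simp
      also have "\<dots> \<le> \<bar>C\<bar> * norm (y - x) powr \<gamma>" by (intro mult_right_mono) auto
      finally show "\<bar>f y - f x\<bar> \<le> \<bar>C\<bar> * norm (y - x) powr (if m = 0 then \<gamma> else 1)" using 0 by simp
    qed (use e in auto)
  next
    case (Suc m')
    with assms(3) obtain G where G: "\<And>x. x \<in> \<Omega> \<Longrightarrow> (f has_derivative (\<lambda>h. G x \<bullet> h)) (at x)"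
      "\<And>b. b \<in> Basis \<Longrightarrow> holder_class_loc m' \<gamma> \<Omega> (\<lambda>x. G x \<bullet> b)" by auto
    have "continuous_on \<Omega> (\<lambda>x. \<Sum>b\<in>Basis. \<bar>G x \<bullet> b\<bar>)"
      by (intro continuous_on_sum continuous_on_rabs holder_class_loc_continuous[OF assms(1,2) G(2)])
    then have "continuous_on (cball x e) (\<lambda>x. \<Sum>b\<in>Basis. \<bar>G x \<bullet> b\<bar>)" using e(2) continuous_on_subset by blast
    then have "bounded ((\<lambda>x. \<Sum>b\<in>Basis. \<bar>G x \<bullet> b\<bar>) ` cball x e)"
      by (intro compact_imp_bounded compact_continuous_image) auto
    then obtain B where B: "\<And>y. y \<in> cball x e \<Longrightarrow> norm (\<Sum>b\<in>Basis. \<bar>G y \<bullet> b\<bar>) \<le> B"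
      unfolding bounded_iff by blast
    have GB: "norm (G y) \<le> B" if "y \<in> cball x e" for y
      using norm_le_l1[of "G y"] B[OF that] by simp
    show ?thesis
    proof (rule that[of e B])
      show "0 \<le> B" using GB[of x] e norm_ge_zero[of "G x"] by (simp only: mem_cball dist_self) linarith
      fix y assume y: "y \<in> cball x e"
      have "\<bar>f y - f x\<bar> \<le> B * norm (y - x)"
        by (rule gradient_bound_imp_lipschitz[of "cball x e" f G]) (use e y G GB in auto)
      then show "\<bar>f y - f x\<bar> \<le> B * norm (y - x) powr (if m = 0 then \<gamma> else 1)" using Suc by simp
    qed (use e in auto)
  qed
qed

text \<open>For \<open>m = 0\<close> the expansion is the Hoelder bound itself, with
  \<open>w = 0\<close> and \<open>p = \<gamma> = \<beta>\<close>. For \<open>m > 0\<close> the mean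
  value inequality for \<open>u\<close> minus its linear part raises the exponent \<open>q\<close>
  of the gradient modulus by 1: \<open>q + 1 = \<beta>\<close> if \<open>m = 1\<close>, and
  \<open>q + 1 = 2 > a\<close> otherwise.\<close>

lemma C_loc_taylor:
  fixes u :: "'a::euclidean_space \<Rightarrow> real"
  assumes \<Omega>: "open \<Omega>" and \<beta>: "0 < \<beta>" "a < \<beta>" "a < 2" and u: "C_loc \<beta> \<Omega> u" and x: "x \<in> \<Omega>"
  obtains e C p w where "0 < e" "0 \<le> C" "a < p" "cball x e \<subseteq> \<Omega>"
    "\<And>y. y \<in> cball x e \<Longrightarrow> \<bar>u y - u x - w \<bullet> (y - x)\<bar> \<le> C * norm (y - x) powr p"
proof -
  define m where "m = nat (\<lceil>\<beta>\<rceil> - 1)"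
  define \<gamma> where "\<gamma> = \<beta> - of_int (\<lceil>\<beta>\<rceil> - 1)"
  have \<gamma>: "0 < \<gamma>" unfolding \<gamma>_def by linarith
  have m\<beta>: "\<beta> = real m + \<gamma>" using \<beta>(1) by (simp add: m_def \<gamma>_def)
  have hu: "holder_class_loc m \<gamma> \<Omega> u" using u by (simp add: C_loc_def m_def \<gamma>_def)
  show ?thesis
  proof (cases m)
    case 0
    obtain e C where "0 < e" "0 \<le> C" "cball x e \<subseteq> \<Omega>"
      "\<And>y. y \<in> cball x e \<Longrightarrow> \<bar>u y - u x\<bar> \<le> C * norm (y - x) powr (if m = 0 then \<gamma> else 1)"
      using holder_class_loc_modulus[OF \<Omega> \<gamma> hu x] by blast
    then show ?thesis using that[of e C \<gamma> 0] 0 m\<beta> \<beta> by simp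
  next
    case (Suc m')
    with hu obtain G where G: "\<And>x. x \<in> \<Omega> \<Longrightarrow> (u has_derivative (\<lambda>h. G x \<bullet> h)) (at x)"
      and Gh: "\<And>b. b \<in> Basis \<Longrightarrow> holder_class_loc m' \<gamma> \<Omega> (\<lambda>x. G x \<bullet> b)" by auto
    define q where "q = (if m' = 0 then \<gamma> else 1)"
    have q: "0 < q" using \<gamma> by (simp add: q_def)
    have "\<forall>b\<in>Basis. \<exists>e C. 0 < e \<and> 0 \<le> C \<and> cball x e \<subseteq> \<Omega> \<and>
        (\<forall>y\<in>cball x e. \<bar>G y \<bullet> b - G x \<bullet> b\<bar> \<le> C * norm (y - x) powr q)"
    proof
      fix b :: 'a assume "b \<in> Basis"
      from holder_class_loc_modulus[OF \<Omega> \<gamma> Gh[OF this] x] obtain e C where "0 < e" "0 \<le> C" "cball x e \<subseteq> \<Omega>"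
        "\<And>y. y \<in> cball x e \<Longrightarrow> \<bar>G y \<bullet> b - G x \<bullet> b\<bar> \<le> C * norm (y - x) powr (if m' = 0 then \<gamma> else 1)"
        by blast
      then show "\<exists>e C. 0 < e \<and> 0 \<le> C \<and> cball x e \<subseteq> \<Omega> \<and>
        (\<forall>y\<in>cball x e. \<bar>G y \<bullet> b - G x \<bullet> b\<bar> \<le> C * norm (y - x) powr q)"
        unfolding q_def by blast
    qed
    then obtain E where "\<forall>b\<in>Basis. \<exists>C. 0 < E b \<and> 0 \<le> C \<and> cball x (E b) \<subseteq> \<Omega> \<and>
        (\<forall>y\<in>cball x (E b). \<bar>G y \<bullet> b - G x \<bullet> b\<bar> \<le> C * norm (y - x) powr q)"
      unfolding bchoice_iff by blast
    then obtain C where EC: "\<And>b. b \<in> Basis \<Longrightarrow> 0 < E b \<and> 0 \<le> C b \<and> cball x (E b) \<subseteq> \<Omega> \<and>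
        (\<forall>y\<in>cball x (E b). \<bar>G y \<bullet> b - G x \<bullet> b\<bar> \<le> C b * norm (y - x) powr q)"
      unfolding bchoice_iff by blast
    define e where "e = Min (E ` Basis)"
    have e: "0 < e" unfolding e_def using EC by simp
    have eE: "e \<le> E b" if "b \<in> Basis" for b unfolding e_def using that by simp
    define C0 where "C0 = (\<Sum>b\<in>Basis. C b)"
    have C0: "0 \<le> C0" unfolding C0_def using EC by (intro sum_nonneg) auto
    obtain b0 :: 'a where "b0 \<in> Basis" using nonempty_Basis by blast
    then have e\<Omega>: "cball x e \<subseteq> \<Omega>" using EC[of b0] eE[of b0] subset_cball[of e "E b0" x] by blast
    have GC: "norm (G y - G x) \<le> C0 * norm (y - x) powr q" if "y \<in> cball x e" for y
    proof -
      have "norm (G y - G x) \<le> (\<Sum>b\<in>Basis. \<bar>(G y - G x) \<bullet> b\<bar>)" by (rule norm_le_l1)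
      also have "\<dots> \<le> (\<Sum>b\<in>Basis. C b * norm (y - x) powr q)"
      proof (rule sum_mono)
        fix b :: 'a assume b: "b \<in> Basis"
        have "y \<in> cball x (E b)" using that eE[OF b] by simp
        then show "\<bar>(G y - G x) \<bullet> b\<bar> \<le> C b * norm (y - x) powr q"
          using EC[OF b] by (simp add: inner_diff_left)
      qed
      finally show ?thesis by (simp add: C0_def sum_distrib_right)
    qed
    show ?thesis
    proof (rule that[OF e C0 _ e\<Omega>, of "q + 1" "G x"])
      show "a < q + 1" using m\<beta> \<beta> Suc by (auto simp: q_def)
      fix y assume y: "y \<in> cball x e"
      let ?w = "\<lambda>z. u z - G x \<bullet> z"
      \<comment> \<open>On this smaller ball, rather than on all of \<open>cball x e\<close>, the
        gradient increment is controlled by \<open>norm (y - x) powr q\<close>.\<close>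
      let ?S = "cball x (norm (y - x))"
      have Se: "?S \<subseteq> cball x e" using y by (intro subset_cball) (simp add: dist_norm norm_minus_commute)
      have "\<bar>?w y - ?w x\<bar> \<le> (C0 * norm (y - x) powr q) * norm (y - x)"
      proof (rule gradient_bound_imp_lipschitz[of ?S ?w "\<lambda>z. G z - G x"])
        fix z assume z: "z \<in> ?S"
        show "(?w has_derivative (\<lambda>h. (G z - G x) \<bullet> h)) (at z)"
        proof -
          have "z \<in> \<Omega>" using z Se e\<Omega> by blast
          then show ?thesis using G[of z] by (auto simp: inner_diff_left intro!: derivative_eq_intros)
        qed
        have "norm (G z - G x) \<le> C0 * norm (z - x) powr q" using z Se by (intro GC) auto
        also have "\<dots> \<le> C0 * norm (y - x) powr q"
          using z C0 q by (intro mult_left_mono powr_mono2) (auto simp: dist_norm norm_minus_commute)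
        finally show "norm (G z - G x) \<le> C0 * norm (y - x) powr q" .
      qed (auto simp: dist_norm norm_minus_commute)
      also have "(C0 * norm (y - x) powr q) * norm (y - x) = C0 * norm (y - x) powr (q + 1)"
        by (simp add: powr_add)
      finally show "\<bar>u y - u x - G x \<bullet> (y - x)\<bar> \<le> C0 * norm (y - x) powr (q + 1)"
        by (simp add: inner_diff_right algebra_simps)
    qed
  qed
qed

section \<open>Borel representatives, removal of small balls, and reflection\<close>

text \<open>Allows an integrand to be exchanged for a Borel representative over
  \<open>lborel\<close>; completeness of \<open>lebesgue\<close> supplies the measurability of
  \<open>f\<close> on \<open>S\<close>.\<close>

lemma set_integral_lborel_AE:
  fixes f g :: "'a::euclidean_space \<Rightarrow> real"
  assumes [measurable]: "S \<in> sets borel" "g \<in> borel_measurable borel"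
    and ae: "AE y in lebesgue. y \<in> S \<longrightarrow> f y = g y"
  shows "set_integrable lebesgue S f \<longleftrightarrow> integrable lborel (\<lambda>y. indicator S y * g y)"
    and "(LINT y : S | lebesgue. f y) = (\<integral>y. indicator S y * g y \<partial>lborel)"
proof -
  have g: "(\<lambda>y. indicator S y * g y) \<in> borel_measurable lborel" by measurable
  have g': "(\<lambda>y. indicator S y * g y) \<in> borel_measurable lebesgue"
    using g by (rule measurable_completion)
  have eq: "AE y in lebesgue. indicator S y * g y = indicator S y *\<^sub>R f y"
    using ae by eventually_elim (auto simp: indicator_def)
  have f: "(\<lambda>y. indicator S y *\<^sub>R f y) \<in> borel_measurable lebesgue"
    by (rule borel_measurable_AE[OF g' eq])
  show "set_integrable lebesgue S f \<longleftrightarrow> integrable lborel (\<lambda>y. indicator S y * g y)"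
    unfolding set_integrable_def integrable_cong_AE[OF g' f eq, symmetric]
    using g by (rule integrable_completion)
  show "(LINT y : S | lebesgue. f y) = (\<integral>y. indicator S y * g y \<partial>lborel)"
    unfolding set_lebesgue_integral_def integral_cong_AE[OF g' f eq, symmetric]
    using g by (rule integral_completion)
qed

text \<open>Dominated convergence with majorant \<open>\<bar>f y\<bar>\<close>: for each
  \<open>y\<close> other than \<open>x\<close> the indicator is eventually 1. The form of
  \<open>M\<close> covers both \<open>lborel\<close> and \<open>lebesgue\<close>, over each of which
  the limit is taken later.\<close>

lemma tendsto_integral_minus_ball:
  fixes f :: "'a::euclidean_space \<Rightarrow> real"
  assumes f: "integrable M f" and M: "sets M = sets lborel \<or> sets M = sets lebesgue"
    and null: "AE y in M. y \<noteq> x"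
  shows "((\<lambda>\<epsilon>. \<integral>y. indicator (- ball x \<epsilon>) y * f y \<partial>M) \<longlongrightarrow> (\<integral>y. f y \<partial>M)) (at_right 0)"
proof (rule tendsto_at_right_sequentially[of 0 1])
  fix S :: "nat \<Rightarrow> real" assume S: "\<And>n. 0 < S n" "S \<longlonglongrightarrow> 0"
  have [measurable]: "- ball x e \<in> sets M" for e
  proof -
    have b: "- ball x e \<in> sets lborel" by simp
    then show ?thesis using M sets_completionI_sets[OF b] by metis
  qed
  show "(\<lambda>n. \<integral>y. indicator (- ball x (S n)) y * f y \<partial>M) \<longlonglongrightarrow> (\<integral>y. f y \<partial>M)"
  proof (rule integral_dominated_convergence)
    show "integrable M (\<lambda>y. \<bar>f y\<bar>)" using f by simp
    show "AE y in M. (\<lambda>n. indicator (- ball x (S n)) y * f y) \<longlonglongrightarrow> f y"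
      using null
    proof eventually_elim
      fix y assume "y \<noteq> x"
      then have "0 < dist x y" by simp
      then have "\<forall>\<^sub>F n in sequentially. S n < dist x y" using S(2) by (rule order_tendstoD(2)[rotated])
      then have "\<forall>\<^sub>F n in sequentially. indicator (- ball x (S n)) y * f y = f y"
        by eventually_elim auto
      then show "(\<lambda>n. indicator (- ball x (S n)) y * f y) \<longlonglongrightarrow> f y" by (rule tendsto_eventually)
    qed
    show "AE y in M. norm (indicator (- ball x (S n)) y * f y) \<le> \<bar>f y\<bar>" for n
      by (intro AE_I2) (auto simp: indicator_def)
  qed (use f in auto)
qed simp

lemma pv_of_integrable:
  fixes f :: "'a::euclidean_space \<Rightarrow> real"
  assumes f: "set_integrable lebesgue D f" and D: "D \<in> sets lebesgue"
  shows "set_integrable lebesgue (D - ball x \<epsilon>) f"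
    and "((\<lambda>\<epsilon>. LINT y : D - ball x \<epsilon> | lebesgue. f y) \<longlongrightarrow> (LINT y : D | lebesgue. f y)) (at_right 0)"
proof -
  show "set_integrable lebesgue (D - ball x \<epsilon>) f"
    using f by (rule set_integrable_subset) (use D in auto)
  have "AE y in lebesgue. y \<noteq> x"
    using AE_not_in[of "{x}" lebesgue] negligible_sing[of x] by (simp add: negligible_iff_null_sets)
  from tendsto_integral_minus_ball[OF f[unfolded set_integrable_def] _ this]
  have "((\<lambda>\<epsilon>. \<integral>y. indicator (- ball x \<epsilon>) y * (indicator D y *\<^sub>R f y) \<partial>lebesgue) \<longlongrightarrow> (LINT y : D | lebesgue. f y)) (at_right 0)"
    by (simp add: set_lebesgue_integral_def)
  moreover have "(\<integral>y. indicator (- ball x \<epsilon>) y * (indicator D y *\<^sub>R f y) \<partial>lebesgue) = (LINT y : D - ball x \<epsilon> | lebesgue. f y)" for \<epsilon>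
    unfolding set_lebesgue_integral_def by (intro Bochner_Integration.integral_cong) (auto simp: indicator_def)
  ultimately show "((\<lambda>\<epsilon>. LINT y : D - ball x \<epsilon> | lebesgue. f y) \<longlongrightarrow> (LINT y : D | lebesgue. f y)) (at_right 0)"
    by simp
qed

lemma lborel_integral_reflect:
  fixes f :: "'a::euclidean_space \<Rightarrow> real"
  assumes [measurable]: "f \<in> borel_measurable borel"
  shows "(\<integral>y. f (c - y) \<partial>lborel) = (\<integral>y. f y \<partial>lborel)"
proof -
  have "lborel = distr lborel borel (\<lambda>y. c - y :: 'a)"
    using lborel_affine[of "-1" c] by (simp add: density_1)
  then have "(\<integral>y. f y \<partial>lborel) = (\<integral>y. f y \<partial>distr lborel borel (\<lambda>y. c - y))" by simp
  also have "\<dots> = (\<integral>y. f (c - y) \<partial>lborel)" by (rule integral_distr) measurable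
  finally show ?thesis by simp
qed

text \<open>The reflection taking \<open>y\<close> to \<open>c - y\<close> preserves
  \<open>lborel\<close>, so the integral equals its own negative.\<close>

lemma odd_integral_zero:
  fixes f :: "'a::euclidean_space \<Rightarrow> real"
  assumes "f \<in> borel_measurable borel" "\<And>y. f (c - y) = - f y"
  shows "(\<integral>y. f y \<partial>lborel) = 0"
  using lborel_integral_reflect[OF assms(1), of c] assms(2) by simp

section \<open>Interior principal value and exterior integral\<close>

context corkscrew_domain
begin

text \<open>Away from \<open>x\<close> the kernel is bounded and \<open>\<Omega>\<close> has finite
  measure. Near \<open>x\<close> the expansion splits the integrand into a linear term, which
  cancels on annuli, and a remainder of order
  \<open>norm (y - x) powr ((p - 2 * s) - real DIM('a))\<close>, integrable because
  \<open>p > 2 * s\<close>.\<close>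

lemma pv_dom:
  assumes x: "x \<in> \<Omega>" and [measurable]: "v \<in> borel_measurable borel" and v: "\<And>y. \<bar>v y\<bar> \<le> M"
    and uv: "AE y in lebesgue. y \<in> \<Omega> \<longrightarrow> u y = v y"
    and e: "0 < e" "cball x e \<subseteq> \<Omega>" and C: "0 \<le> C" and p: "2 * s < p"
    and taylor: "\<And>y. y \<in> cball x e \<Longrightarrow> \<bar>u y - u x - w \<bullet> (y - x)\<bar> \<le> C * norm (y - x) powr p"
  shows "pv_integrable x \<Omega> (\<lambda>y. (u x - u y) * K x y)"
proof -
  let ?\<nu> = "real DIM('a) + 2 * s"
  define A where "A = u x"
  define g where "g y = (A - v y) * K x y" for y
  define l where "l y = w \<bullet> (y - x) * K x y" for y
  \<comment> \<open>On \<open>ball x e\<close> the sum \<open>g + l\<close> is, almost everywhere,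
    minus the Taylor remainder times the kernel. Only the variable value \<open>u y\<close> is
    replaced by the Borel function \<open>v y\<close>; the constant \<open>A\<close> remains the
    true \<open>u x\<close>.\<close>
  define h where "h y = indicator \<Omega> y * g y + indicator (ball x e) y * l y" for y
  have [measurable]: "ball x \<epsilon> \<in> sets borel" for \<epsilon> by simp
  have [measurable]: "g \<in> borel_measurable borel" "l \<in> borel_measurable borel" "h \<in> borel_measurable borel"
    unfolding g_def l_def h_def by measurable
  have ball_\<Omega>: "ball x e \<subseteq> \<Omega>" using e(2) ball_subset_cball by blast
  have vA: "\<bar>A - v y\<bar> \<le> \<bar>A\<bar> + M" for y using v[of y] by linarith
  have M: "0 \<le> \<bar>A\<bar> + M" using vA[of x] by linarith
  have fin\<Omega>: "integrable lborel (\<lambda>y. indicator \<Omega> y :: real)"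
    using bounded_dom by (intro integrable_real_indicator emeasure_bounded_finite) auto
  have Kout: "K x y \<le> \<epsilon> powr (- ?\<nu>)" if "0 < \<epsilon>" "y \<notin> ball x \<epsilon>" for y \<epsilon>
    using that s_pos by (intro frac_kernel_le) (auto simp: dist_norm)
  have gout: "\<bar>g y\<bar> \<le> (\<bar>A\<bar> + M) * \<epsilon> powr (- ?\<nu>)" if "0 < \<epsilon>" "y \<notin> ball x \<epsilon>" for y \<epsilon>
    unfolding g_def abs_mult using vA Kout[OF that] M by (intro mult_mono) auto
  have gint: "integrable lborel (\<lambda>y. indicator (\<Omega> - ball x \<epsilon>) y * g y)" if "0 < \<epsilon>" for \<epsilon>
  proof (rule Bochner_Integration.integrable_bound)
    show "integrable lborel (\<lambda>y. ((\<bar>A\<bar> + M) * \<epsilon> powr (- ?\<nu>)) * indicator \<Omega> y :: real)"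
      by (intro integrable_mult_right fin\<Omega>)
    show "AE y in lborel. norm (indicator (\<Omega> - ball x \<epsilon>) y * g y) \<le> norm (((\<bar>A\<bar> + M) * \<epsilon> powr (- ?\<nu>)) * indicator \<Omega> y :: real)"
      using gout[OF that] M by (intro AE_I2) (auto simp: indicator_def)
  qed measurable
  have lint: "integrable lborel (\<lambda>y. indicator (ball x e - ball x \<epsilon>) y * l y)" if "0 < \<epsilon>" for \<epsilon>
  proof (rule Bochner_Integration.integrable_bound)
    show "integrable lborel (\<lambda>y. (norm w * e * \<epsilon> powr (- ?\<nu>)) * indicator \<Omega> y :: real)"
      by (intro integrable_mult_right fin\<Omega>)
    show "AE y in lborel. norm (indicator (ball x e - ball x \<epsilon>) y * l y) \<le> norm ((norm w * e * \<epsilon> powr (- ?\<nu>)) * indicator \<Omega> y :: real)"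
    proof (intro AE_I2)
      fix y
      show "norm (indicator (ball x e - ball x \<epsilon>) y * l y) \<le> norm ((norm w * e * \<epsilon> powr (- ?\<nu>)) * indicator \<Omega> y :: real)"
      proof (cases "y \<in> ball x e - ball x \<epsilon>")
        case True
        have "\<bar>w \<bullet> (y - x)\<bar> \<le> norm w * norm (y - x)" by (rule Cauchy_Schwarz_ineq2)
        also have "\<dots> \<le> norm w * e" using True by (intro mult_left_mono) (auto simp: dist_norm norm_minus_commute)
        finally have "\<bar>l y\<bar> \<le> norm w * e * \<epsilon> powr (- ?\<nu>)"
          unfolding l_def abs_mult using Kout[OF that, of y] True e(1) by (intro mult_mono) auto
        moreover have "y \<in> \<Omega>" using True ball_\<Omega> by auto
        ultimately show ?thesis using True e(1) by (simp add: abs_mult)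
      qed simp
    qed
  qed measurable
  \<comment> \<open>The first-order Taylor term is odd about \<open>x\<close>, so subtracting it does not change the integral outside
    a ball, and \<open>h\<close> is absolutely integrable.\<close>
  have lzero: "(\<integral>y. indicator (ball x e - ball x \<epsilon>) y * l y \<partial>lborel) = 0" for \<epsilon>
  proof (rule odd_integral_zero[where c = "2 *\<^sub>R x"])
    fix y
    have eq: "2 *\<^sub>R x - y - x = - (y - x)" "x - (2 *\<^sub>R x - y) = - (x - y)" by (simp_all add: scaleR_2)
    have "2 *\<^sub>R x - y \<in> ball x \<delta> \<longleftrightarrow> y \<in> ball x \<delta>" for \<delta>
      unfolding mem_ball dist_norm eq by (simp add: norm_minus_commute)
    then show "indicator (ball x e - ball x \<epsilon>) (2 *\<^sub>R x - y) * l (2 *\<^sub>R x - y) = - (indicator (ball x e - ball x \<epsilon>) y * l y)"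
      unfolding l_def frac_kernel_def eq
      by (auto simp: indicator_def inner_diff_right norm_minus_commute diff_divide_distrib)
  qed measurable
  have hint: "integrable lborel h"
  proof (rule Bochner_Integration.integrable_bound)
    let ?b = "\<lambda>y. (\<bar>A\<bar> + M) * e powr (- ?\<nu>) * indicator \<Omega> y + C * (norm (y - x) powr ((p - 2 * s) - real DIM('a)) * indicator (ball x e) y)"
    have "integrable lborel (\<lambda>y. norm (y - x) powr ((p - 2 * s) - real DIM('a)) * indicator (ball x e) y)"
    proof (rule integrableI_bounded)
      show "(\<integral>\<^sup>+y. ennreal (norm (norm (y - x) powr ((p - 2 * s) - real DIM('a)) * indicator (ball x e) y)) \<partial>lborel) < \<infinity>"
        using nn_integral_powr_ball_finite[of "p - 2 * s" e x] p e
        by (simp add: ennreal_mult ennreal_indicator)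
    qed measurable
    then show "integrable lborel ?b" using fin\<Omega> by (intro Bochner_Integration.integrable_add integrable_mult_right)
    have "AE y in lborel. y \<in> \<Omega> \<longrightarrow> u y = v y" using uv by (simp add: AE_completion_iff)
    then show "AE y in lborel. norm (h y) \<le> norm (?b y)"
    proof eventually_elim
      fix y assume uv: "y \<in> \<Omega> \<longrightarrow> u y = v y"
      have "0 \<le> M" using v[of x] by linarith
      then have b0: "0 \<le> ?b y" using C by (intro add_nonneg_nonneg mult_nonneg_nonneg) auto
      have "\<bar>h y\<bar> \<le> ?b y"
      proof (cases "y \<in> ball x e")
        case True
        then have y: "y \<in> \<Omega>" "y \<in> cball x e" using ball_\<Omega> by auto
        have "h y = - ((u y - u x - w \<bullet> (y - x)) * K x y)"
          using True y uv by (simp add: h_def g_def l_def A_def algebra_simps)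
        then have "\<bar>h y\<bar> = \<bar>u y - u x - w \<bullet> (y - x)\<bar> * K x y" by (simp add: abs_mult)
        also have "\<dots> \<le> (C * norm (y - x) powr p) * K x y" using taylor[OF y(2)] by (rule mult_right_mono) simp
        also have "\<dots> = C * norm (y - x) powr ((p - 2 * s) - real DIM('a))"
        proof -
          have "p + - ?\<nu> = (p - 2 * s) - real DIM('a)" by simp
          then have "norm (y - x) powr p * norm (y - x) powr (- ?\<nu>) = norm (y - x) powr ((p - 2 * s) - real DIM('a))"
            by (simp only: powr_add[symmetric])
          then show ?thesis by (simp only: frac_kernel_powr norm_minus_commute[of x y] mult.assoc)
        qed
        also have "\<dots> \<le> ?b y" using True y M by simp
        finally show ?thesis .
      next
        case False
        then show ?thesis using gout[OF e(1) False] M C by (auto simp: h_def indicator_def)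
      qed
      then show "norm (h y) \<le> norm (?b y)" using b0 by simp
    qed
  qed measurable
  have uvg: "AE y in lebesgue. y \<in> \<Omega> - ball x \<epsilon> \<longrightarrow> (u x - u y) * K x y = g y" for \<epsilon>
    using uv by eventually_elim (auto simp: g_def A_def)
  have "((\<lambda>\<epsilon>. \<integral>y. indicator (- ball x \<epsilon>) y * h y \<partial>lborel) \<longlongrightarrow> (\<integral>y. h y \<partial>lborel)) (at_right 0)"
    using AE_lborel_singleton by (intro tendsto_integral_minus_ball hint) auto
  moreover have "\<forall>\<^sub>F \<epsilon> in at_right 0. (\<integral>y. indicator (- ball x \<epsilon>) y * h y \<partial>lborel) = (LINT y : \<Omega> - ball x \<epsilon> | lebesgue. (u x - u y) * K x y)"
    unfolding eventually_at_filter
  proof (intro always_eventually allI impI)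
    fix \<epsilon> :: real assume "\<epsilon> \<in> {0<..}"
    then have \<epsilon>: "0 < \<epsilon>" by simp
    have "(\<integral>y. indicator (- ball x \<epsilon>) y * h y \<partial>lborel) =
       (\<integral>y. indicator (\<Omega> - ball x \<epsilon>) y * g y + indicator (ball x e - ball x \<epsilon>) y * l y \<partial>lborel)"
      by (intro Bochner_Integration.integral_cong) (auto simp: h_def indicator_def)
    also have "\<dots> = (\<integral>y. indicator (\<Omega> - ball x \<epsilon>) y * g y \<partial>lborel)"
      using gint[OF \<epsilon>] lint[OF \<epsilon>] lzero by simp
    also have "\<dots> = (LINT y : \<Omega> - ball x \<epsilon> | lebesgue. (u x - u y) * K x y)"
      using set_integral_lborel_AE(2)[OF _ _ uvg] by simp
    finally show "(\<integral>y. indicator (- ball x \<epsilon>) y * h y \<partial>lborel) = (LINT y : \<Omega> - ball x \<epsilon> | lebesgue. (u x - u y) * K x y)" .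
  qed
  ultimately have "((\<lambda>\<epsilon>. LINT y : \<Omega> - ball x \<epsilon> | lebesgue. (u x - u y) * K x y) \<longlongrightarrow> (\<integral>y. h y \<partial>lborel)) (at_right 0)"
    by (rule Lim_transform_eventually)
  moreover have "set_integrable lebesgue (\<Omega> - ball x \<epsilon>) (\<lambda>y. (u x - u y) * K x y)" if "0 < \<epsilon>" for \<epsilon>
    using set_integral_lborel_AE(1)[OF _ _ uvg] gint[OF that] by simp
  ultimately show ?thesis unfolding pv_integrable_def by blast
qed

text \<open>The vanishing normal derivative gives \<open>u z * N z\<close> as the integral of
  \<open>v y * K z y\<close> over \<open>\<Omega>\<close>, hence
  \<open>(u x - u z) * N z = I z\<close> for almost every exterior \<open>z\<close>. Multiplying by
  \<open>K x z / N z\<close> turns the exterior integrand into \<open>h\<close>, to which Fubini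
  applies.\<close>

lemma exterior_integral:
  assumes x: "x \<in> \<Omega>" and [measurable]: "v \<in> borel_measurable borel" and v: "\<And>y. \<bar>v y\<bar> \<le> M"
    and uv: "AE y in lebesgue. y \<in> \<Omega> \<longrightarrow> u y = v y"
    and neumann: "AE z in lebesgue. z \<in> - \<Omega> \<longrightarrow> nonlocal_normal_deriv s \<Omega> u z = 0"
  shows "set_integrable lebesgue \<Omega> (\<lambda>y. (u x - u y) * neumann_kernel s \<Omega> x y)"
    and "set_integrable lebesgue (- \<Omega>) (\<lambda>z. (u x - u z) * K x z)"
    and "(LINT z : - \<Omega> | lebesgue. (u x - u z) * K x z) = (LINT y : \<Omega> | lebesgue. (u x - u y) * neumann_kernel s \<Omega> x y)"
proof -
  define A where "A = u x"
  define g where "g y = (A - v y) * neumann_kernel s \<Omega> x y" for y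
  define I where "I z = (\<integral>y. indicator \<Omega> y * ((A - v y) * K z y) \<partial>lborel)" for z
  define h where "h z = indicator (- closure \<Omega>) z * (K x z / N z * I z)" for z
  have gm: "g \<in> borel_measurable borel"
    unfolding g_def using neumann_kernel_measurable[OF x] by measurable
  have hm: "h \<in> borel_measurable borel"
  proof -
    have "I \<in> borel_measurable borel"
      unfolding I_def by (intro lborel.borel_measurable_lebesgue_integral) measurable
    then show ?thesis unfolding h_def by measurable
  qed
  have ug: "AE y in lebesgue. y \<in> \<Omega> \<longrightarrow> (u x - u y) * neumann_kernel s \<Omega> x y = g y"
    using uv by eventually_elim (auto simp: g_def A_def)
  have vint: "integrable lborel (\<lambda>y. indicator \<Omega> y * (v y * K z y))" if z: "z \<notin> closure \<Omega>" for z
  proof (rule Bochner_Integration.integrable_bound)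
    show "integrable lborel (\<lambda>y. M * (indicator \<Omega> y * K z y))"
      using kernel_integrable[OF z] by simp
    have "0 \<le> M" using v[of x] by linarith
    then show "AE y in lborel. norm (indicator \<Omega> y * (v y * K z y)) \<le> norm (M * (indicator \<Omega> y * K z y))"
      using v by (intro AE_I2) (auto simp: abs_mult indicator_def intro!: mult_right_mono)
  qed measurable
  have split: "(\<integral>y. indicator \<Omega> y * ((B - v y) * K z y) \<partial>lborel) = B * N z - (\<integral>y. indicator \<Omega> y * (v y * K z y) \<partial>lborel)"
    if z: "z \<notin> closure \<Omega>" for B z
  proof -
    have "(\<integral>y. indicator \<Omega> y * ((B - v y) * K z y) \<partial>lborel) = (\<integral>y. B * (indicator \<Omega> y * K z y) - indicator \<Omega> y * (v y * K z y) \<partial>lborel)"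
      by (intro Bochner_Integration.integral_cong) (auto simp: algebra_simps)
    also have "\<dots> = B * N z - (\<integral>y. indicator \<Omega> y * (v y * K z y) \<partial>lborel)"
      using kernel_integrable[OF z] vint[OF z] by (simp add: N_lborel)
    finally show ?thesis .
  qed
  have uh: "AE z in lebesgue. z \<in> - \<Omega> \<longrightarrow> (u x - u z) * K x z = h z"
    using neumann AE_not_frontier
  proof eventually_elim
    fix z assume nd: "z \<in> - \<Omega> \<longrightarrow> nonlocal_normal_deriv s \<Omega> u z = 0" and fr: "z \<notin> frontier \<Omega>"
    show "z \<in> - \<Omega> \<longrightarrow> (u x - u z) * K x z = h z"
    proof
      assume "z \<in> - \<Omega>"
      then have z: "z \<notin> closure \<Omega>" using fr open_dom by (simp add: frontier_def interior_open)
      have N: "0 < N z" using N_pos[OF z] .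
      have "AE y in lebesgue. y \<in> \<Omega> \<longrightarrow> (u z - u y) * K z y = (u z - v y) * K z y"
        using uv by eventually_elim auto
      then have "(LINT y : \<Omega> | lebesgue. (u z - u y) * K z y) = (\<integral>y. indicator \<Omega> y * ((u z - v y) * K z y) \<partial>lborel)"
        by (intro set_integral_lborel_AE(2)) measurable
      \<comment> \<open>The normalizing factor is the inverse of \<open>N z > 0\<close>, so a
        vanishing derivative forces the integral itself to vanish.\<close>
      moreover have "(LINT y : \<Omega> | lebesgue. (u z - u y) * K z y) = 0"
        using nd \<open>z \<in> - \<Omega>\<close> N by (simp add: nonlocal_normal_deriv_def N_def[symmetric])
      ultimately have "(\<integral>y. indicator \<Omega> y * (v y * K z y) \<partial>lborel) = u z * N z"
        using split[OF z, of "u z"] by simp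
      then have "I z = (A - u z) * N z" using split[OF z, of A] by (simp add: I_def algebra_simps)
      then show "(u x - u z) * K x z = h z" using z N by (simp add: h_def A_def)
    qed
  qed
  have ind: "indicator (- \<Omega>) z * h z = h z" for z
    using closure_subset by (auto simp: h_def indicator_def)
  note fub = fubini_neumann[OF x \<open>v \<in> borel_measurable borel\<close> v, of A, folded g_def I_def, folded h_def]
  show "set_integrable lebesgue \<Omega> (\<lambda>y. (u x - u y) * neumann_kernel s \<Omega> x y)"
    using set_integral_lborel_AE(1)[OF _ gm ug] fub(1) by simp
  show "set_integrable lebesgue (- \<Omega>) (\<lambda>z. (u x - u z) * K x z)"
    using set_integral_lborel_AE(1)[OF _ hm uh] fub(2) by (simp add: ind)
  show "(LINT z : - \<Omega> | lebesgue. (u x - u z) * K x z) = (LINT y : \<Omega> | lebesgue. (u x - u y) * neumann_kernel s \<Omega> x y)"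
    using set_integral_lborel_AE(2)[OF _ hm uh] set_integral_lborel_AE(2)[OF _ gm ug] fub(3) by (simp add: ind)
qed

end

section \<open>Bounded representatives and additivity of principal values\<close>

text \<open>Extension by 0 gives a function with a Borel representative, and truncation makes the
  bound hold everywhere. The level is \<open>\<bar>M\<bar>\<close> because an almost everywhere
  bound \<open>M\<close> may be negative when \<open>\<Omega>\<close> is null.\<close>

lemma Linfty_on_borel_version:
  fixes u :: "'a::euclidean_space \<Rightarrow> real"
  assumes [measurable]: "\<Omega> \<in> sets borel" and u: "Linfty_on \<Omega> u"
  obtains v M where "v \<in> borel_measurable borel" "\<And>y. \<bar>v y\<bar> \<le> M" "AE y in lebesgue. y \<in> \<Omega> \<longrightarrow> u y = v y"
proof -
  obtain M where um: "u \<in> borel_measurable (lebesgue_on \<Omega>)" and M: "AE x in lebesgue_on \<Omega>. \<bar>u x\<bar> \<le> M"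
    using u by (auto simp: Linfty_on_def)
  have M': "AE x in lebesgue. x \<in> \<Omega> \<longrightarrow> \<bar>u x\<bar> \<le> M" using M by (subst (asm) AE_restrict_space_iff) auto
  have "(\<lambda>x. if x \<in> \<Omega> then u x else 0) \<in> borel_measurable lebesgue"
    using um by (intro borel_measurable_if_I) auto
  then obtain v where v: "v \<in> borel_measurable lborel" "AE x in lborel. (if x \<in> \<Omega> then u x else 0) = v x"
    using completion_ex_borel_measurable_real by blast
  show ?thesis
  proof (rule that[of "\<lambda>y. max (- \<bar>M\<bar>) (min \<bar>M\<bar> (v y))" "\<bar>M\<bar>"])
    show "(\<lambda>y. max (- \<bar>M\<bar>) (min \<bar>M\<bar> (v y))) \<in> borel_measurable borel" using v(1) by measurable
    show "\<bar>max (- \<bar>M\<bar>) (min \<bar>M\<bar> (v y))\<bar> \<le> \<bar>M\<bar>" for y by linarith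
    show "AE y in lebesgue. y \<in> \<Omega> \<longrightarrow> u y = max (- \<bar>M\<bar>) (min \<bar>M\<bar> (v y))"
      using AE_completion[OF v(2)] M' by eventually_elim auto
  qed
qed

lemma pv_integral_eqI:
  "((\<lambda>\<epsilon>. LINT y : D - ball x \<epsilon> | lebesgue. f y) \<longlongrightarrow> l) (at_right 0) \<Longrightarrow> pv_integral x D f = l"
  unfolding pv_integral_def by (rule tendsto_Lim[OF trivial_limit_at_right_real])

lemma pv_integral_add_integrable:
  fixes f g :: "'a::euclidean_space \<Rightarrow> real"
  assumes f: "pv_integrable x D f" and g: "set_integrable lebesgue D g" and D: "D \<in> sets lebesgue"
  shows "pv_integrable x D (\<lambda>y. f y + g y)"
    and "pv_integral x D (\<lambda>y. f y + g y) = pv_integral x D f + (LINT y : D | lebesgue. g y)"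
proof -
  obtain l where l: "((\<lambda>\<epsilon>. LINT y : D - ball x \<epsilon> | lebesgue. f y) \<longlongrightarrow> l) (at_right 0)"
    and fi: "\<And>\<epsilon>. 0 < \<epsilon> \<Longrightarrow> set_integrable lebesgue (D - ball x \<epsilon>) f" using f by (auto simp: pv_integrable_def)
  note gi = pv_of_integrable[OF g D]
  have "\<forall>\<^sub>F \<epsilon> in at_right 0. (LINT y : D - ball x \<epsilon> | lebesgue. f y) + (LINT y : D - ball x \<epsilon> | lebesgue. g y)
      = (LINT y : D - ball x \<epsilon> | lebesgue. f y + g y)"
    unfolding eventually_at_filter by (intro always_eventually allI impI) (simp add: set_integral_add fi gi)
  with tendsto_add[OF l gi(2)]
  have lim: "((\<lambda>\<epsilon>. LINT y : D - ball x \<epsilon> | lebesgue. f y + g y) \<longlongrightarrow> l + (LINT y : D | lebesgue. g y)) (at_right 0)"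
    by (rule Lim_transform_eventually)
  then show "pv_integrable x D (\<lambda>y. f y + g y)"
    unfolding pv_integrable_def using fi gi(1) by blast
  show "pv_integral x D (\<lambda>y. f y + g y) = pv_integral x D f + (LINT y : D | lebesgue. g y)"
    using pv_integral_eqI[OF lim] pv_integral_eqI[OF l] by simp
qed

text \<open>The part over \<open>- \<Omega>\<close> converges to an ordinary integral, so all
  cancellation takes place inside \<open>\<Omega>\<close>.\<close>

lemma pv_integral_UNIV_split:
  fixes f :: "'a::euclidean_space \<Rightarrow> real"
  assumes \<Omega>: "open \<Omega>" "x \<in> \<Omega>" and f: "pv_integrable x \<Omega> f" and fc: "set_integrable lebesgue (- \<Omega>) f"
  shows "pv_integrable x UNIV f"
    and "pv_integral x UNIV f = pv_integral x \<Omega> f + (LINT y : - \<Omega> | lebesgue. f y)"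
proof -
  have ms: "\<Omega> \<in> sets lebesgue" "- \<Omega> \<in> sets lebesgue" using \<Omega> by auto
  obtain l where l: "((\<lambda>\<epsilon>. LINT y : \<Omega> - ball x \<epsilon> | lebesgue. f y) \<longlongrightarrow> l) (at_right 0)"
    and fi: "\<And>\<epsilon>. 0 < \<epsilon> \<Longrightarrow> set_integrable lebesgue (\<Omega> - ball x \<epsilon>) f" using f by (auto simp: pv_integrable_def)
  note gi = pv_of_integrable[OF fc ms(2)]
  have U: "UNIV - ball x \<epsilon> = (\<Omega> - ball x \<epsilon>) \<union> (- \<Omega> - ball x \<epsilon>)" for \<epsilon> by auto
  have "\<forall>\<^sub>F \<epsilon> in at_right 0. (LINT y : \<Omega> - ball x \<epsilon> | lebesgue. f y) + (LINT y : - \<Omega> - ball x \<epsilon> | lebesgue. f y)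
      = (LINT y : UNIV - ball x \<epsilon> | lebesgue. f y)"
    unfolding eventually_at_filter U
    by (intro always_eventually allI impI set_integral_Un[symmetric] fi gi) auto
  with tendsto_add[OF l gi(2)]
  have lim: "((\<lambda>\<epsilon>. LINT y : UNIV - ball x \<epsilon> | lebesgue. f y) \<longlongrightarrow> l + (LINT y : - \<Omega> | lebesgue. f y)) (at_right 0)"
    by (rule Lim_transform_eventually)
  moreover have "set_integrable lebesgue (UNIV - ball x \<epsilon>) f" if "0 < \<epsilon>" for \<epsilon>
    unfolding U using fi[OF that] gi(1) ms by (intro set_integrable_Un) auto
  ultimately show "pv_integrable x UNIV f" unfolding pv_integrable_def by blast
  show "pv_integral x UNIV f = pv_integral x \<Omega> f + (LINT y : - \<Omega> | lebesgue. f y)"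
    using pv_integral_eqI[OF lim] pv_integral_eqI[OF l] by simp
qed

theorem corollary1p2:
  fixes \<Omega> :: "'a::euclidean_space set" and u :: "'a \<Rightarrow> real" and s \<alpha> c :: real
  assumes "0 < s" and "s < 1" and "c > 0"
    and "open \<Omega>" and "bounded \<Omega>" and "C11_boundary \<Omega>"
    and "\<alpha> > 0" and "C_loc (2 * s + \<alpha>) \<Omega> u" and "Linfty_on \<Omega> u"
    and "AE x in lebesgue. x \<in> - \<Omega> \<longrightarrow> nonlocal_normal_deriv s \<Omega> u x = 0"
  shows "(\<forall>x\<in>\<Omega>.
      pv_integrable x UNIV (\<lambda>y. (u x - u y) * frac_kernel s x y) \<and>
      pv_integrable x \<Omega> (\<lambda>y. (u x - u y) * frac_kernel s x y) \<and>
      set_integrable lebesgue \<Omega> (\<lambda>y. (u x - u y) * neumann_kernel s \<Omega> x y) \<and>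
      pv_integrable x \<Omega> (\<lambda>y. (u x - u y) * (frac_kernel s x y + neumann_kernel s \<Omega> x y)) \<and>
      frac_laplacian c s u x =
        regional_frac_laplacian c s \<Omega> u x
        + c * (LINT y : \<Omega> | lebesgue. (u x - u y) * neumann_kernel s \<Omega> x y) \<and>
      frac_laplacian c s u x =
        c * pv_integral x \<Omega> (\<lambda>y. (u x - u y) * (frac_kernel s x y + neumann_kernel s \<Omega> x y)))
    \<and> (\<forall>x\<in>\<Omega>. \<forall>y\<in>\<Omega>. neumann_kernel s \<Omega> x y > 0)
    \<and> (\<forall>x\<in>\<Omega>. \<forall>y\<in>\<Omega>. neumann_kernel s \<Omega> x y = neumann_kernel s \<Omega> y x)
    \<and> continuous_on (\<Omega> \<times> \<Omega>) (\<lambda>(x, y). neumann_kernel s \<Omega> x y)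
    \<and> (\<forall>x\<in>\<Omega>. \<exists>C>0. \<forall>y\<in>\<Omega>.
          neumann_kernel s \<Omega> x y \<le> C * (1 + \<bar>ln (infdist y (- \<Omega>))\<bar>) \<and>
          neumann_kernel s \<Omega> x y \<ge> 1 / C * (1 + \<bar>ln (infdist y (- \<Omega>))\<bar>))"
proof (cases "\<Omega> = {}")
  \<comment> \<open>The locale presupposes a nonempty domain; for the empty one every claim is
    trivial.\<close>
  case True
  then show ?thesis by simp
next
  case False
  obtain \<kappa> r where \<kappa>: "0 < \<kappa>" "0 < r" "corkscrew \<kappa> r \<Omega>" "corkscrew \<kappa> r (- \<Omega>)" "negligible (frontier \<Omega>)"
    using C11_corkscrew[OF assms(4,5,6)] by blast
  interpret corkscrew_domain \<Omega> s \<kappa> r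
    using assms(1,4,5) False \<kappa> by unfold_locales
  let ?k = "neumann_kernel s \<Omega>"
  obtain v M where v: "v \<in> borel_measurable borel" "\<And>y. \<bar>v y\<bar> \<le> M"
    and uv: "AE y in lebesgue. y \<in> \<Omega> \<longrightarrow> u y = v y"
    by (rule Linfty_on_borel_version[OF _ assms(9)]) (use assms(4) in auto)
  obtain e where e: "0 < e" "\<And>x y. x \<in> \<Omega> \<Longrightarrow> y \<in> \<Omega> \<Longrightarrow> e * (1 + \<bar>ln (infdist y (- \<Omega>))\<bar>) \<le> ?k x y"
    by (rule neumann_kernel_lower) blast
  have "pv_integrable x UNIV (\<lambda>y. (u x - u y) * frac_kernel s x y) \<and>
      pv_integrable x \<Omega> (\<lambda>y. (u x - u y) * frac_kernel s x y) \<and>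
      set_integrable lebesgue \<Omega> (\<lambda>y. (u x - u y) * ?k x y) \<and>
      pv_integrable x \<Omega> (\<lambda>y. (u x - u y) * (frac_kernel s x y + ?k x y)) \<and>
      frac_laplacian c s u x =
        regional_frac_laplacian c s \<Omega> u x + c * (LINT y : \<Omega> | lebesgue. (u x - u y) * ?k x y) \<and>
      frac_laplacian c s u x = c * pv_integral x \<Omega> (\<lambda>y. (u x - u y) * (frac_kernel s x y + ?k x y))"
    if x: "x \<in> \<Omega>" for x
  proof -
    \<comment> \<open>The expansion must have order above \<open>2 * s\<close>, while a first-order
      one reaches at most order 2; \<open>s < 1\<close> leaves the room.\<close>
    have \<beta>: "0 < 2 * s + \<alpha>" "2 * s < 2 * s + \<alpha>" "2 * s < 2" using assms by auto
    obtain e C p w where e: "0 < e" "0 \<le> C" "2 * s < p" "cball x e \<subseteq> \<Omega>"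
      "\<And>y. y \<in> cball x e \<Longrightarrow> \<bar>u y - u x - w \<bullet> (y - x)\<bar> \<le> C * norm (y - x) powr p"
      using C_loc_taylor[OF assms(4) \<beta> assms(8) x] by blast
    have pv: "pv_integrable x \<Omega> (\<lambda>y. (u x - u y) * K x y)"
      by (rule pv_dom[OF x v uv e(1,4,2,3,5)])
    note ext = exterior_integral[OF x v uv assms(10)]
    note univ = pv_integral_UNIV_split[OF assms(4) x pv ext(2)]
    have "\<Omega> \<in> sets lebesgue" using assms(4) by auto
    note sum = pv_integral_add_integrable[OF pv ext(1) this, folded distrib_left]
    show ?thesis
      using pv ext univ sum by (simp add: frac_laplacian_def regional_frac_laplacian_def distrib_left)
  qed
  moreover have "?k x y > 0" if "x \<in> \<Omega>" "y \<in> \<Omega>" for x y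
  proof -
    have "0 < e * (1 + \<bar>ln (infdist y (- \<Omega>))\<bar>)" using e(1) by (intro mult_pos_pos) auto
    then show ?thesis using e(2)[OF that] by linarith
  qed
  moreover have "?k x y = ?k y x" for x y
    unfolding neumann_kernel_def by (simp add: mult.commute)
  moreover have "\<exists>C>0. \<forall>y\<in>\<Omega>. ?k x y \<le> C * (1 + \<bar>ln (infdist y (- \<Omega>))\<bar>) \<and>
          ?k x y \<ge> 1 / C * (1 + \<bar>ln (infdist y (- \<Omega>))\<bar>)" if x: "x \<in> \<Omega>" for x
  proof -
    obtain C where C: "0 < C" "\<And>y. y \<in> \<Omega> \<Longrightarrow> ?k x y \<le> C * (1 + \<bar>ln (infdist y (- \<Omega>))\<bar>)"
      using neumann_kernel_upper[OF x] by metis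
    \<comment> \<open>One constant has to serve both bounds: \<open>C \<le> C'\<close> for the upper
      and \<open>1 / C' \<le> e\<close> for the lower.\<close>
    define C' where "C' = max C (1 / e)"
    have C': "0 < C'" "C \<le> C'" "1 / C' \<le> e"
      using C(1) e(1) by (auto simp: C'_def field_simps max_def)
    show ?thesis
    proof (intro exI[of _ C'] conjI ballI)
      fix y assume y: "y \<in> \<Omega>"
      have "C * (1 + \<bar>ln (infdist y (- \<Omega>))\<bar>) \<le> C' * (1 + \<bar>ln (infdist y (- \<Omega>))\<bar>)"
        "1 / C' * (1 + \<bar>ln (infdist y (- \<Omega>))\<bar>) \<le> e * (1 + \<bar>ln (infdist y (- \<Omega>))\<bar>)"
        using C' by (intro mult_right_mono; simp)+
      then show "?k x y \<le> C' * (1 + \<bar>ln (infdist y (- \<Omega>))\<bar>)" "?k x y \<ge> 1 / C' * (1 + \<bar>ln (infdist y (- \<Omega>))\<bar>)"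
        using C(2)[OF y] e(2)[OF x y] by linarith+
    qed (rule C')
  qed
  ultimately show ?thesis using neumann_kernel_continuous by blast
qed

end
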